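(* Let $\mu\in\mathcal P_\lambda$ be non-degenerate and assume there exists a non-degenerate $\mu_{\mathrm G}\in\mathcal P_{\mathrm G}$ with $\operatorname{KL}(\mu,\mu_{\mathrm G})<\infty$. Let $\nu\in\mathcal P_{\mathrm G}$ be non-degenerate. Then $\operatorname{KL}(\mu,\mathcal{GP}(\mu))<\infty$ and $$\operatorname{KL}(\mu,\nu)-\operatorname{KL}(\mu,\mathcal{GP}(\mu))=\mathcal G(\mu,\nu).$$
   Context: Take $\mathcal X=\mathcal Y=\mathbb R$. Let $I$ be the set of all finite tuples $\mathbf x=(x_1,\dots,x_n)\in\mathbb R^n$, $n\ge1$, of pairwise distinct inputs, and $P_{\mathbf x}f=(f(x_1),\dots,f(x_n))$. $\mathcal P$ denotes the probability measures on $\mathbb R^{\mathbb R}$ with the cylindrical $\sigma$-algebra; $P_{\mathbf x}\mu$ is the finite-dimensional distribution of $\mu$ at $\mathbf x$. $\mathcal P^n$: Borel probability measures on $\mathbb R^n$; $\mathcal P^n_{\mathrm G}$: Gaussian ones (possibly singular); $\mathcal P_{\mathrm G}$: Gaussian processes. $\mathcal P_\lambda$: processes all of whose finite-dimensional distributions at $\mathbf x\in I$ have a Lebesgue density. A distribution on $\mathbb R^n$ is non-degenerate if it has a strictly positive definite covariance matrix; a process is non-degenerate if all its finite-dimensional distributions at $\mathbf x\in I$ are. $\mathcal{GP}(\mu)$ is the Gaussian process with the same mean and covariance function as $\mu$. For processes, $\operatorname{KL}(\mu,\nu)=\sup_{\mathbf x\in I}\operatorname{KL}(P_{\mathbf x}\mu,P_{\mathbf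 x}\nu)$. Gaussian divergence: for $\mu\in\mathcal P^n$, $\nu\in\mathcal P^n_{\mathrm G}$, $\mathcal G(\mu,\nu)=\operatorname{KL}(\mu,\nu)-\inf_{\xi\in\mathcal P^n_{\mathrm G}}\operatorname{KL}(\mu,\xi)$ if this infimum is finite, and $\infty$ otherwise; for $\mu\in\mathcal P$, $\nu\in\mathcal P_{\mathrm G}$, $\mathcal G(\mu,\nu)=\sup_{\mathbf x\in I}\mathcal G(P_{\mathbf x}\mu,P_{\mathbf x}\nu)$. *)

theory Defs
  imports "HOL-Probability.Probability"
begin

text \<open>R^n is represented by functions nat => real (extensional on {..<n}) with the
  product Lebesgue measure; its sigma algebra is the Borel sigma algebra.\<close>
definition Rn :: "nat \<Rightarrow> (nat \<Rightarrow> real) measure" where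
  "Rn n = PiM {..<n} (\<lambda>_. lborel)"

definition path_space :: "(real \<Rightarrow> real) measure" where
  "path_space = PiM UNIV (\<lambda>_. lborel)"

definition inputs :: "real list set" where
  "inputs = {xs. xs \<noteq> [] \<and> distinct xs}"

definition fdd :: "(real \<Rightarrow> real) measure \<Rightarrow> real list \<Rightarrow> (nat \<Rightarrow> real) measure" where
  "fdd \<mu> xs = distr \<mu> (Rn (length xs)) (\<lambda>f. \<lambda>i\<in>{..<length xs}. f (xs ! i))"

definition is_process :: "(real \<Rightarrow> real) measure \<Rightarrow> bool" where
  "is_process \<mu> \<longleftrightarrow> prob_space \<mu> \<and> sets \<mu> = sets path_space"

definition is_prob_Rn :: "nat \<Rightarrow> (nat \<Rightarrow> real) measure \<Rightarrow> bool" where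
  "is_prob_Rn n P \<longleftrightarrow> prob_space P \<and> sets P = sets (Rn n)"

text \<open>KL(P,Q) = integral of log(dP/dQ) w.r.t. P if P << Q and this is integrable,
  and infinity otherwise (for P << Q the negative part of log(dP/dQ) is always
  P-integrable, so non-integrability means the integral is +infinity).\<close>
definition KL :: "'a measure \<Rightarrow> 'a measure \<Rightarrow> ereal" where
  "KL P Q = (if sets P = sets Q \<and> absolutely_continuous Q P
                \<and> integrable P (\<lambda>x. ln (enn2real (RN_deriv Q P x)))
             then ereal (\<integral>x. ln (enn2real (RN_deriv Q P x)) \<partial>P)
             else \<infinity>)"

definition KL_proc :: "(real \<Rightarrow> real) measure \<Rightarrow> (real \<Rightarrow> real) measure \<Rightarrow> ereal" where
  "KL_proc \<mu> \<nu> = (SUP xs\<in>inputs. KL (fdd \<mu> xs) (fdd \<nu> xs))"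

definition gaussian_Rn :: "nat \<Rightarrow> (nat \<Rightarrow> real) measure \<Rightarrow> bool" where
  "gaussian_Rn n P \<longleftrightarrow> is_prob_Rn n P \<and>
     (\<forall>a :: nat \<Rightarrow> real. \<exists>m \<sigma>.
        (\<sigma> = 0 \<and> distr P lborel (\<lambda>y. \<Sum>i<n. a i * y i) = return lborel m) \<or>
        (\<sigma> > 0 \<and> distr P lborel (\<lambda>y. \<Sum>i<n. a i * y i) = density lborel (\<lambda>t. ennreal (normal_density m \<sigma> t))))"

definition gaussian_process :: "(real \<Rightarrow> real) measure \<Rightarrow> bool" where
  "gaussian_process \<nu> \<longleftrightarrow> is_process \<nu> \<and> (\<forall>xs\<in>inputs. gaussian_Rn (length xs) (fdd \<nu> xs))"

definition has_lebesgue_density :: "nat \<Rightarrow> (nat \<Rightarrow> real) measure \<Rightarrow> bool" where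
  "has_lebesgue_density n P \<longleftrightarrow> (\<exists>f \<in> borel_measurable (Rn n). P = density (Rn n) f)"

definition in_P_lambda :: "(real \<Rightarrow> real) measure \<Rightarrow> bool" where
  "in_P_lambda \<mu> \<longleftrightarrow> is_process \<mu> \<and> (\<forall>xs\<in>inputs. has_lebesgue_density (length xs) (fdd \<mu> xs))"

definition mean_vec :: "(nat \<Rightarrow> real) measure \<Rightarrow> nat \<Rightarrow> real" where
  "mean_vec P i = (\<integral>y. y i \<partial>P)"

definition cov_mat :: "(nat \<Rightarrow> real) measure \<Rightarrow> nat \<Rightarrow> nat \<Rightarrow> real" where
  "cov_mat P i j = (\<integral>y. (y i - mean_vec P i) * (y j - mean_vec P j) \<partial>P)"

definition nondegenerate_Rn :: "nat \<Rightarrow> (nat \<Rightarrow> real) measure \<Rightarrow> bool" where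
  "nondegenerate_Rn n P \<longleftrightarrow>
     (\<forall>i<n. integrable P (\<lambda>y. (y i)\<^sup>2)) \<and>
     (\<forall>a :: nat \<Rightarrow> real. (\<exists>i<n. a i \<noteq> 0) \<longrightarrow>
        (\<Sum>i<n. \<Sum>j<n. a i * a j * cov_mat P i j) > 0)"

definition nondegenerate_proc :: "(real \<Rightarrow> real) measure \<Rightarrow> bool" where
  "nondegenerate_proc \<mu> \<longleftrightarrow> (\<forall>xs\<in>inputs. nondegenerate_Rn (length xs) (fdd \<mu> xs))"

definition mean_fun :: "(real \<Rightarrow> real) measure \<Rightarrow> real \<Rightarrow> real" where
  "mean_fun \<mu> t = (\<integral>f. f t \<partial>\<mu>)"

definition cov_fun :: "(real \<Rightarrow> real) measure \<Rightarrow> real \<Rightarrow> real \<Rightarrow> real" where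
  "cov_fun \<mu> s t = (\<integral>f. (f s - mean_fun \<mu> s) * (f t - mean_fun \<mu> t) \<partial>\<mu>)"

definition GP_of :: "(real \<Rightarrow> real) measure \<Rightarrow> (real \<Rightarrow> real) measure" where
  "GP_of \<mu> = (THE \<nu>. gaussian_process \<nu> \<and> mean_fun \<nu> = mean_fun \<mu> \<and> cov_fun \<nu> = cov_fun \<mu>)"

definition gauss_div_Rn :: "nat \<Rightarrow> (nat \<Rightarrow> real) measure \<Rightarrow> (nat \<Rightarrow> real) measure \<Rightarrow> ereal" where
  "gauss_div_Rn n P Q =
     (let i = (INF \<xi>\<in>{\<xi>. gaussian_Rn n \<xi>}. KL P \<xi>)
      in if \<bar>i\<bar> \<noteq> \<infinity> then KL P Q - i else \<infinity>)"

definition gauss_div :: "(real \<Rightarrow> real) measure \<Rightarrow> (real \<Rightarrow> real) measure \<Rightarrow> ereal" where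
  "gauss_div \<mu> \<nu> = (SUP xs\<in>inputs. gauss_div_Rn (length xs) (fdd \<mu> xs) (fdd \<nu> xs))"

end

theory Submission
  imports Defs
begin

text \<open>
  Let \<open>P\<close>, \<open>G\<close>, \<open>Q\<close> be the finite-dimensional distributions of \<open>\<mu>\<close>, \<open>GP_of \<mu>\<close>, \<open>\<nu>\<close> at the same inputs.
  The logarithms of the densities of \<open>G\<close> and \<open>Q\<close> are quadratic polynomials, and \<open>P\<close> and \<open>G\<close> share
  their first two moments, so \<open>KL P Q = KL P G + KL G Q\<close>. Hence \<open>G\<close> minimises \<open>KL P\<close> among the Gaussian
  laws (singular ones give \<open>\<infinity>\<close> because \<open>P\<close> is non-degenerate), and the Gaussian divergence of \<open>P\<close> and \<open>Q\<close>
  is \<open>KL G Q\<close>. By the data processing inequality both summands increase with the set of inputs, so the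
  supremum of the sum is the sum of the suprema. The process \<open>GP_of \<mu>\<close> exists by Kolmogorov extension
  and is unique because characteristic functions determine the laws on \<open>\<real>\<^sup>n\<close>.
\<close>

section \<open>Uniqueness of characteristic functions on \<open>\<real>\<^sup>J\<close>\<close>

text \<open>The definition of a Gaussian law speaks only of the laws of linear functionals and
  supplies no density, whereas divergences need densities. Characteristic functions form the bridge:
  a law with an explicit density is built by adding one coordinate at a time, each normal given the
  earlier ones, and the non-degenerate Gaussian law with the same mean and covariance is then
  identified with it. This route uses neither determinants nor inverse matrices. All that has to be
  known of a log-density is that it is a constant minus a sum of squares of affine functions, since
  the expectation of such a function depends on the first two moments alone.

  The extended reals impose a second constraint: the claim is a subtraction, so the supremum of
  \<open>KL P G\<close> must be finite. This is where \<open>\<mu>G\<close> enters. Its marginals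
  compete with \<open>G\<close> in the minimisation, so \<open>KL_proc \<mu> \<mu>G\<close> bounds
  every \<open>KL P G\<close>. The same bound makes the infima in \<open>gauss_div\<close> finite.
  The other summand \<open>KL G Q\<close> is finite for each list of inputs, but its supremum may be
  infinite.\<close>

lemma weighted_law_eqI:
  fixes M N :: "'a measure" and X u :: "'a \<Rightarrow> real"
  assumes "prob_space M" "prob_space N" and sets: "sets M = sets N"
    and [measurable]: "X \<in> borel_measurable N" "u \<in> borel_measurable N" "A \<in> sets borel"
    and u: "\<And>x. 0 \<le> u x" "\<And>x. u x \<le> B"
    and eq: "\<And>t. (\<integral>x. u x *\<^sub>R iexp (t * X x) \<partial>M) = (\<integral>x. u x *\<^sub>R iexp (t * X x) \<partial>N)"
  shows "(\<integral>x. u x * indicator A (X x) \<partial>M) = (\<integral>x. u x * indicator A (X x) \<partial>N)"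
proof -
  interpret M: prob_space M by fact
  interpret N: prob_space N by fact
  note [measurable_cong] = sets
  have uB: "\<bar>u x\<bar> \<le> B" for x using u[of x] by simp
  have iM: "integrable M u" and iN: "integrable N u"
    using uB by (auto intro!: M.integrable_const_bound[where B=B] N.integrable_const_bound[where B=B])
  \<comment> \<open>Division by the mass \<open>c\<close> turns \<open>u\<close> into a probability
    density, and Levy's uniqueness theorem applies to the law of \<open>X\<close> under it. The case
    \<open>t = 0\<close> of \<open>eq\<close> shows that both measures give the same mass; if it is
    0, the weight vanishes almost everywhere.\<close>
  define c where "c = (\<integral>x. u x \<partial>M)"
  have "complex_of_real (\<integral>x. u x \<partial>M) = of_real (\<integral>x. u x \<partial>N)"
    using eq[of 0] by (simp add: scaleR_conv_of_real)
  then have cN: "c = (\<integral>x. u x \<partial>N)" unfolding c_def using of_real_eq_iff by blast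
  show ?thesis
  proof (cases "c = 0")
    case True
    have "AE x in M. u x = 0" using True iM u unfolding c_def
      by (subst (asm) integral_nonneg_eq_0_iff_AE) auto
    moreover have "AE x in N. u x = 0" using True iN u unfolding cN
      by (subst (asm) integral_nonneg_eq_0_iff_AE) auto
    ultimately show ?thesis
      by (subst (1 2) integral_cong_AE[where g="\<lambda>_. 0"]) auto
  next
    case False
    have "c \<ge> 0" unfolding c_def using u by (intro integral_nonneg_AE) auto
    with False have c: "c > 0" by simp
    define v where "v x = u x / c" for x
    have v[measurable]: "v \<in> borel_measurable N" and v0: "v x \<ge> 0" for x
      using c u by (auto simp: v_def[abs_def])
    have pM: "prob_space (density M v)"
    proof
      have "(\<integral>\<^sup>+x. ennreal (v x) \<partial>M) = ennreal (\<integral>x. v x \<partial>M)"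
        using iM v0 by (intro nn_integral_eq_integral) (auto simp: v_def)
      also have "(\<integral>x. v x \<partial>M) = 1" using c by (simp add: v_def c_def)
      finally show "emeasure (density M v) (space (density M v)) = 1"
        by (simp add: emeasure_density cong: nn_integral_cong)
    qed
    have pN: "prob_space (density N v)"
    proof
      have "(\<integral>\<^sup>+x. ennreal (v x) \<partial>N) = ennreal (\<integral>x. v x \<partial>N)"
        using iN v0 by (intro nn_integral_eq_integral) (auto simp: v_def)
      also have "(\<integral>x. v x \<partial>N) = 1" using c by (simp add: v_def cN)
      finally show "emeasure (density N v) (space (density N v)) = 1"
        by (simp add: emeasure_density cong: nn_integral_cong)
    qed
    have "distr (density M v) borel X = distr (density N v) borel X" (is "?D = ?E")
    proof (rule Levy_uniqueness)
      show "real_distribution ?D" by (rule prob_space.real_distribution_distr[OF pM]) simp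
      show "real_distribution ?E" by (rule prob_space.real_distribution_distr[OF pN]) simp
      show "char ?D = char ?E"
      proof
        fix t
        have "char ?D t = (\<integral>x. v x *\<^sub>R iexp (t * X x) \<partial>M)"
          using v0 unfolding char_def by (subst integral_distr) (auto simp: integral_density)
        also have "\<dots> = (\<integral>x. (1/c) *\<^sub>R (u x *\<^sub>R iexp (t * X x)) \<partial>M)"
          by (simp add: v_def field_simps)
        also have "\<dots> = (1/c) *\<^sub>R (\<integral>x. u x *\<^sub>R iexp (t * X x) \<partial>M)"
          by (rule integral_scaleR_right)
        also have "\<dots> = (1/c) *\<^sub>R (\<integral>x. u x *\<^sub>R iexp (t * X x) \<partial>N)" by (simp only: eq)
        also have "\<dots> = (\<integral>x. (1/c) *\<^sub>R (u x *\<^sub>R iexp (t * X x)) \<partial>N)"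
          by (rule integral_scaleR_right[symmetric])
        also have "\<dots> = (\<integral>x. v x *\<^sub>R iexp (t * X x) \<partial>N)" by (simp add: v_def field_simps)
        also have "\<dots> = char ?E t"
          using v0 unfolding char_def by (subst integral_distr) (auto simp: integral_density)
        finally show "char ?D t = char ?E t" .
      qed
    qed
    moreover have "(\<integral>x. v x * indicator A (X x) \<partial>M) = (\<integral>r. indicator A r \<partial>?D)"
      using v0 by (subst integral_distr) (auto simp: integral_density)
    moreover have "(\<integral>x. v x * indicator A (X x) \<partial>N) = (\<integral>r. indicator A r \<partial>?E)"
      using v0 by (subst integral_distr) (auto simp: integral_density)
    ultimately have "(\<integral>x. v x * indicator A (X x) \<partial>M) = (\<integral>x. v x * indicator A (X x) \<partial>N)"
      by (simp only:)
    then show ?thesis using c by (simp add: v_def)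
  qed
qed

text \<open>The weight \<open>iexp (\<theta> x)\<close> is complex, whereas
  \<open>weighted_law_eqI\<close> wants bounded nonnegative weights. Real and imaginary part are
  therefore shifted to \<open>2 + cos (\<theta> x)\<close> and \<open>2 + sin (\<theta> x)\<close>,
  which lie between 1 and 3. Euler's formulas express their weighted characteristic functions
  through the hypothesis at \<open>s = 0, 1, -1\<close>, and the contribution of the shift is
  subtracted at the end.\<close>

lemma iexp_weighted_law_eqI:
  fixes M N :: "'a measure" and X w \<theta> :: "'a \<Rightarrow> real"
  assumes "prob_space M" "prob_space N" and sets: "sets M = sets N"
    and [measurable]: "X \<in> borel_measurable N" "w \<in> borel_measurable N" "\<theta> \<in> borel_measurable N"
      "A \<in> sets borel"
    and w: "\<And>x. 0 \<le> w x" "\<And>x. w x \<le> 1"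
    and eq: "\<And>s t. (\<integral>x. w x *\<^sub>R iexp (t * X x + s * \<theta> x) \<partial>M) = (\<integral>x. w x *\<^sub>R iexp (t * X x + s * \<theta> x) \<partial>N)"
  shows "(\<integral>x. (w x * indicator A (X x)) *\<^sub>R iexp (\<theta> x) \<partial>M) = (\<integral>x. (w x * indicator A (X x)) *\<^sub>R iexp (\<theta> x) \<partial>N)"
proof -
  interpret M: prob_space M by fact
  interpret N: prob_space N by fact
  note [measurable_cong] = sets
  have iM: "integrable M (\<lambda>x. w x *\<^sub>R iexp (f x))" if [measurable]: "f \<in> borel_measurable N" for f
    using w by (intro M.integrable_const_bound[where B=1]) auto
  have iN: "integrable N (\<lambda>x. w x *\<^sub>R iexp (f x))" if [measurable]: "f \<in> borel_measurable N" for f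
    using w by (intro N.integrable_const_bound[where B=1]) auto
  have cosE: "(w x * (2 + cos (\<theta> x))) *\<^sub>R iexp (t * X x) =
      2 * (w x *\<^sub>R iexp (t * X x + 0 * \<theta> x)) + (1/2) * (w x *\<^sub>R iexp (t * X x + 1 * \<theta> x))
      + (1/2) * (w x *\<^sub>R iexp (t * X x + (-1) * \<theta> x))" for x t
    by (simp add: cos_of_real[symmetric] cos_exp_eq exp_add[symmetric] scaleR_conv_of_real
        algebra_simps del: cos_of_real)
  have sinE: "(w x * (2 + sin (\<theta> x))) *\<^sub>R iexp (t * X x) =
      2 * (w x *\<^sub>R iexp (t * X x + 0 * \<theta> x)) + (- \<i>/2) * (w x *\<^sub>R iexp (t * X x + 1 * \<theta> x))
      + (\<i>/2) * (w x *\<^sub>R iexp (t * X x + (-1) * \<theta> x))" for x t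
    by (simp add: sin_of_real[symmetric] sin_exp_eq exp_add[symmetric] scaleR_conv_of_real
        algebra_simps del: sin_of_real) (simp add: exp_add exp_minus field_simps)
  have lin: "(\<integral>x. a * (w x *\<^sub>R iexp (t * X x + 0 * \<theta> x)) + b * (w x *\<^sub>R iexp (t * X x + 1 * \<theta> x))
      + c * (w x *\<^sub>R iexp (t * X x + (-1) * \<theta> x)) \<partial>M) =
      (\<integral>x. a * (w x *\<^sub>R iexp (t * X x + 0 * \<theta> x)) + b * (w x *\<^sub>R iexp (t * X x + 1 * \<theta> x))
      + c * (w x *\<^sub>R iexp (t * X x + (-1) * \<theta> x)) \<partial>N)" for a b c t
    by (subst (1 2) Bochner_Integration.integral_add
         | (intro integrable_mult_right iM iN Bochner_Integration.integrable_add; measurable)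
         | (simp only: integral_mult_right_zero eq))+
  have e0: "(\<integral>x. w x * indicator A (X x) \<partial>M) = (\<integral>x. w x * indicator A (X x) \<partial>N)"
    by (rule weighted_law_eqI[OF assms(1-3), where B=1]) (use w eq[where s=0] in auto)
  have c0: "(\<integral>x. (w x * (2 + cos (\<theta> x))) * indicator A (X x) \<partial>M) =
      (\<integral>x. (w x * (2 + cos (\<theta> x))) * indicator A (X x) \<partial>N)"
  proof (rule weighted_law_eqI[OF assms(1-3), where B=3])
    show "0 \<le> w x * (2 + cos (\<theta> x))" for x
      using w(1)[of x] cos_ge_minus_one[of "\<theta> x"] by (intro mult_nonneg_nonneg; linarith)
    show "w x * (2 + cos (\<theta> x)) \<le> 3" for x
      using w[of x] cos_le_one[of "\<theta> x"] cos_ge_minus_one[of "\<theta> x"] mult_mono[of "w x" 1 "2 + cos (\<theta> x)" 3] by linarith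
  qed (simp_all only: cosE lin, measurable)
  have s0: "(\<integral>x. (w x * (2 + sin (\<theta> x))) * indicator A (X x) \<partial>M) =
      (\<integral>x. (w x * (2 + sin (\<theta> x))) * indicator A (X x) \<partial>N)"
  proof (rule weighted_law_eqI[OF assms(1-3), where B=3])
    show "0 \<le> w x * (2 + sin (\<theta> x))" for x
      using w(1)[of x] sin_ge_minus_one[of "\<theta> x"] by (intro mult_nonneg_nonneg; linarith)
    show "w x * (2 + sin (\<theta> x)) \<le> 3" for x
      using w[of x] sin_le_one[of "\<theta> x"] sin_ge_minus_one[of "\<theta> x"] mult_mono[of "w x" 1 "2 + sin (\<theta> x)" 3] by linarith
  qed (simp_all only: sinE lin, measurable)
  have bnd: "\<bar>w x * r * indicator A (X x)\<bar> \<le> 3" if "\<bar>r\<bar> \<le> 3" for x r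
    using w[of x] that mult_mono[of "w x" 1 "\<bar>r\<bar>" 3] by (auto simp: abs_mult split: split_indicator)
  have jM: "integrable M (\<lambda>x. w x * r x * indicator A (X x))"
    if [measurable]: "r \<in> borel_measurable N" and "\<And>x. \<bar>r x\<bar> \<le> 3" for r
    using bnd that by (intro M.integrable_const_bound[where B=3]) auto
  have jN: "integrable N (\<lambda>x. w x * r x * indicator A (X x))"
    if [measurable]: "r \<in> borel_measurable N" and "\<And>x. \<bar>r x\<bar> \<le> 3" for r
    using bnd that by (intro N.integrable_const_bound[where B=3]) auto
  have b3: "\<bar>cos (\<theta> x)\<bar> \<le> 3" "\<bar>sin (\<theta> x)\<bar> \<le> 3" "\<bar>2 + cos (\<theta> x)\<bar> \<le> 3" "\<bar>2 + sin (\<theta> x)\<bar> \<le> 3" for x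
    using abs_cos_le_one[of "\<theta> x"] abs_sin_le_one[of "\<theta> x"] by linarith+
  have expand: "(\<integral>x. w x * (2 + r x) * indicator A (X x) \<partial>L) =
      2 * (\<integral>x. w x * indicator A (X x) \<partial>L) + (\<integral>x. w x * r x * indicator A (X x) \<partial>L)"
    if "integrable L (\<lambda>x. w x * 1 * indicator A (X x))" "integrable L (\<lambda>x. w x * r x * indicator A (X x))" for L r
  proof -
    have "(\<integral>x. w x * (2 + r x) * indicator A (X x) \<partial>L) =
        (\<integral>x. 2 * (w x * 1 * indicator A (X x)) + w x * r x * indicator A (X x) \<partial>L)"
      by (simp add: algebra_simps)
    also have "\<dots> = (\<integral>x. 2 * (w x * 1 * indicator A (X x)) \<partial>L) + (\<integral>x. w x * r x * indicator A (X x) \<partial>L)"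
      by (intro Bochner_Integration.integral_add integrable_mult_right that)
    finally show ?thesis by simp
  qed
  have c1: "(\<integral>x. w x * cos (\<theta> x) * indicator A (X x) \<partial>M) = (\<integral>x. w x * cos (\<theta> x) * indicator A (X x) \<partial>N)"
    using c0 e0 expand[OF jM jM, of "\<lambda>x. cos (\<theta> x)"] expand[OF jN jN, of "\<lambda>x. cos (\<theta> x)"] b3 by simp
  have s1: "(\<integral>x. w x * sin (\<theta> x) * indicator A (X x) \<partial>M) = (\<integral>x. w x * sin (\<theta> x) * indicator A (X x) \<partial>N)"
    using s0 e0 expand[OF jM jM, of "\<lambda>x. sin (\<theta> x)"] expand[OF jN jN, of "\<lambda>x. sin (\<theta> x)"] b3 by simp
  have split: "(w x * indicator A (X x)) *\<^sub>R iexp (\<theta> x) =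
     of_real (w x * cos (\<theta> x) * indicator A (X x)) + \<i> * of_real (w x * sin (\<theta> x) * indicator A (X x))" for x
    by (simp add: cis_conv_exp[symmetric] complex_eq_iff)
  show ?thesis unfolding split
    using c1 s1 b3
    by (subst (1 2) Bochner_Integration.integral_add) (auto intro!: integrable_mult_right integrable_of_real jM jN simp del: of_real_mult)
qed

text \<open>Turning the characters \<open>y \<mapsto> iexp (a k * y k)\<close> into indicators of Borel sets one coordinate at a
  time reduces uniqueness on \<open>\<real>\<^sup>J\<close> to the one-dimensional theorem.\<close>
theorem PiM_eqI_char:
  fixes M N :: "('i \<Rightarrow> real) measure"
  assumes J: "finite J" and "prob_space M" "prob_space N"
    and M: "sets M = sets (PiM J (\<lambda>_. lborel))" and N: "sets N = sets (PiM J (\<lambda>_. lborel))"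
    and eq: "\<And>a. (\<integral>y. iexp (\<Sum>j\<in>J. a j * y j) \<partial>M) = (\<integral>y. iexp (\<Sum>j\<in>J. a j * y j) \<partial>N)"
  shows "M = N"
proof -
  interpret M: prob_space M by fact
  interpret N: prob_space N by fact
  have sets: "sets M = sets N" using M N by simp
  note [measurable_cong] = M N
  have *: "(\<integral>y. (\<Prod>j\<in>K. indicator (A j) (y j)) *\<^sub>R iexp (\<Sum>j\<in>L. a j * y j) \<partial>M) =
      (\<integral>y. (\<Prod>j\<in>K. indicator (A j) (y j)) *\<^sub>R iexp (\<Sum>j\<in>L. a j * y j) \<partial>N)"
    if "K \<union> L = J" "K \<inter> L = {}" "\<And>j. j \<in> K \<Longrightarrow> A j \<in> sets borel" for K L a A
  proof -
    have "finite K" using J that(1) by auto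
    then show ?thesis using that
    proof (induction K arbitrary: L a rule: finite_induct)
      case empty
      then show ?case using eq by simp
    next
      case (insert k K)
      have [measurable]: "(\<lambda>y. y j) \<in> borel_measurable N" if "j \<in> J" for j
        using that by simp
      have sub: "k \<in> J" "K \<subseteq> J" "L \<subseteq> J" "k \<notin> L" "finite L" using insert J by (auto intro: finite_subset)
      have [measurable]: "A j \<in> sets borel" if "j \<in> insert k K" for j using insert.prems that by auto
      have w[measurable]: "(\<lambda>y. \<Prod>j\<in>K. indicator (A j) (y j) :: real) \<in> borel_measurable N"
        using sub insert.prems by (intro borel_measurable_prod borel_measurable_indicator') (auto intro: measurable_sets)
      have th[measurable]: "(\<lambda>y. \<Sum>j\<in>L. a j * y j) \<in> borel_measurable N"
        using sub by (intro borel_measurable_sum borel_measurable_times) auto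
      have "(\<integral>y. ((\<Prod>j\<in>K. indicator (A j) (y j)) * indicator (A k) (y k)) *\<^sub>R iexp (\<Sum>j\<in>L. a j * y j) \<partial>M) =
        (\<integral>y. ((\<Prod>j\<in>K. indicator (A j) (y j)) * indicator (A k) (y k)) *\<^sub>R iexp (\<Sum>j\<in>L. a j * y j) \<partial>N)"
      proof (rule iexp_weighted_law_eqI[OF assms(2,3) sets])
        show "(\<lambda>y. y k) \<in> borel_measurable N" using sub by simp
        show "(\<Prod>j\<in>K. indicator (A j) (y j) :: real) \<le> 1" for y
          by (intro prod_le_1) auto
        fix s t
        \<comment> \<open>Frequency \<open>t\<close> on coordinate \<open>k\<close> and
          \<open>s\<close> times the old frequencies on \<open>L\<close>: with this \<open>b\<close>
          both parameters of \<open>iexp_weighted_law_eqI\<close> are covered by the induction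
          hypothesis for \<open>insert k L\<close>.\<close>
        define b where "b j = (if j = k then t else s * a j)" for j
        have "(\<Sum>j\<in>insert k L. b j * y j) = t * y k + s * (\<Sum>j\<in>L. a j * y j)" for y
          using sub by (auto simp: b_def sum_distrib_left mult.assoc intro!: sum.cong)
        then show "(\<integral>y. (\<Prod>j\<in>K. indicator (A j) (y j)) *\<^sub>R iexp (t * y k + s * (\<Sum>j\<in>L. a j * y j)) \<partial>M) =
          (\<integral>y. (\<Prod>j\<in>K. indicator (A j) (y j)) *\<^sub>R iexp (t * y k + s * (\<Sum>j\<in>L. a j * y j)) \<partial>N)"
          using insert.IH[of "insert k L" b] insert.prems insert.hyps by auto
      qed (auto intro!: prod_nonneg)
      then show ?case using insert.hyps by (simp add: mult.commute)
    qed
  qed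
  have rect: "emeasure M (Pi\<^sub>E J A) = emeasure N (Pi\<^sub>E J A)" if A: "\<And>j. j \<in> J \<Longrightarrow> A j \<in> sets lborel" for A
  proof -
    have ind: "(\<Prod>j\<in>J. indicator (A j) (y j)) = (indicator (Pi\<^sub>E J A) y :: real)" if "y \<in> space N" for y
    proof -
      have "y \<in> extensional J" using that sets_eq_imp_space_eq[OF N] by (auto simp: space_PiM PiE_def)
      then show ?thesis using J
        by (auto simp: indicator_def PiE_def Pi_def prod_zero_iff intro!: prod.neutral)
    qed
    have S: "Pi\<^sub>E J A \<in> sets N" unfolding N using A J by (intro sets_PiM_I_finite) auto
    have "(\<integral>y. indicator (Pi\<^sub>E J A) y *\<^sub>R (1::complex) \<partial>M) = (\<integral>y. (\<Prod>j\<in>J. indicator (A j) (y j)) *\<^sub>R 1 \<partial>M)"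
      by (intro Bochner_Integration.integral_cong refl) (simp only: ind sets_eq_imp_space_eq[OF sets])
    also have "\<dots> = (\<integral>y. (\<Prod>j\<in>J. indicator (A j) (y j)) *\<^sub>R 1 \<partial>N)"
      using *[of J "{}" A] A by simp
    also have "\<dots> = (\<integral>y. indicator (Pi\<^sub>E J A) y *\<^sub>R (1::complex) \<partial>N)"
      by (intro Bochner_Integration.integral_cong refl) (simp only: ind)
    finally have "complex_of_real (\<integral>y. indicator (Pi\<^sub>E J A) y \<partial>M) = of_real (\<integral>y. indicator (Pi\<^sub>E J A) y \<partial>N)"
      by (simp only: scaleR_conv_of_real mult_1_right integral_complex_of_real)
    then have "measure M (Pi\<^sub>E J A) = measure N (Pi\<^sub>E J A)"
      using S sets unfolding of_real_eq_iff by simp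
    then show ?thesis by (simp add: M.emeasure_eq_measure N.emeasure_eq_measure)
  qed
  show ?thesis
  proof (rule measure_eqI_PiM_infinite[OF M N _ M.finite_measure_axioms])
    fix A :: "'i \<Rightarrow> real set" and H assume "finite H" "H \<subseteq> J" "\<And>i. i \<in> H \<Longrightarrow> A i \<in> sets lborel"
    then show "emeasure M (prod_emb J (\<lambda>_. lborel) H (Pi\<^sub>E H A)) = emeasure N (prod_emb J (\<lambda>_. lborel) H (Pi\<^sub>E H A))"
      using rect[of "\<lambda>i. if i \<in> H then A i else space lborel"] by (subst (1 2) prod_emb_PiE) auto
  qed
qed

section \<open>Gaussian densities\<close>

definition posdef_on :: "'i set \<Rightarrow> ('i \<Rightarrow> 'i \<Rightarrow> real) \<Rightarrow> bool" where
  "posdef_on J V \<longleftrightarrow> (\<forall>i\<in>J. \<forall>j\<in>J. V i j = V j i) \<and>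
     (\<forall>a. (\<exists>j\<in>J. a j \<noteq> 0) \<longrightarrow> (\<Sum>i\<in>J. \<Sum>j\<in>J. a i * a j * V i j) > 0)"

lemma posdef_on_subset:
  assumes "posdef_on J V" "finite J" "K \<subseteq> J"
  shows "posdef_on K V"
  unfolding posdef_on_def
proof (intro conjI allI impI)
  show "\<forall>i\<in>K. \<forall>j\<in>K. V i j = V j i" using assms unfolding posdef_on_def by blast
  fix a :: "'a \<Rightarrow> real" assume a: "\<exists>j\<in>K. a j \<noteq> 0"
  define b where "b j = (if j \<in> K then a j else 0)" for j
  have "\<exists>j\<in>J. b j \<noteq> 0" using a assms by (auto simp: b_def)
  then have "(\<Sum>i\<in>J. \<Sum>j\<in>J. b i * b j * V i j) > 0" using assms by (simp add: posdef_on_def)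
  also have "(\<Sum>i\<in>J. \<Sum>j\<in>J. b i * b j * V i j) = (\<Sum>i\<in>K. \<Sum>j\<in>J. b i * b j * V i j)"
    using assms by (intro sum.mono_neutral_right) (auto simp: b_def)
  also have "\<dots> = (\<Sum>i\<in>K. \<Sum>j\<in>K. b i * b j * V i j)"
    using assms by (intro sum.cong sum.mono_neutral_right) (auto simp: b_def)
  also have "\<dots> = (\<Sum>i\<in>K. \<Sum>j\<in>K. a i * a j * V i j)" by (simp add: b_def)
  finally show "(\<Sum>i\<in>K. \<Sum>j\<in>K. a i * a j * V i j) > 0" .
qed

lemma posdef_on_nonneg:
  assumes "posdef_on J V"
  shows "0 \<le> (\<Sum>i\<in>J. \<Sum>j\<in>J. a i * a j * V i j)"
proof (cases "\<exists>j\<in>J. a j \<noteq> 0")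
  case True
  then show ?thesis using assms unfolding posdef_on_def by (intro less_imp_le) auto
qed (auto intro!: sum_nonneg)

lemma quadratic_form_insert:
  fixes V :: "'i \<Rightarrow> 'i \<Rightarrow> real"
  assumes "finite J" "k \<notin> J" "\<And>j. j \<in> J \<Longrightarrow> V j k = V k j"
  shows "(\<Sum>i\<in>insert k J. \<Sum>j\<in>insert k J. a i * a j * V i j) =
    (\<Sum>i\<in>J. \<Sum>j\<in>J. a i * a j * V i j) + 2 * a k * (\<Sum>j\<in>J. a j * V k j) + (a k)\<^sup>2 * V k k"
proof -
  have "(\<Sum>i\<in>J. a i * a k * V i k) = a k * (\<Sum>j\<in>J. a j * V k j)"
    "(\<Sum>j\<in>J. a k * a j * V k j) = a k * (\<Sum>j\<in>J. a j * V k j)"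
    using assms by (auto simp: sum_distrib_left intro!: sum.cong)
  then show ?thesis using assms by (simp add: sum.distrib power2_eq_square)
qed

text \<open>The vector \<open>c\<close> holds the coefficients of the regression of coordinate
  \<open>k\<close> on those in \<open>J\<close>. Completing the square in the coordinates of
  \<open>J\<close> splits off the conditional variance of \<open>k\<close>, which is positive
  because it is the value of the form at the vector with entries \<open>- c j\<close> on
  \<open>J\<close> and 1 at \<open>k\<close>.\<close>

lemma schur_complement:
  fixes V :: "'i \<Rightarrow> 'i \<Rightarrow> real"
  assumes J: "finite J" "k \<notin> J" and V: "posdef_on (insert k J) V"
    and c: "\<And>i. i \<in> J \<Longrightarrow> (\<Sum>j\<in>J. V i j * c j) = V i k"
  shows "V k k - (\<Sum>j\<in>J. V k j * c j) > 0"
    and "(\<Sum>i\<in>insert k J. \<Sum>j\<in>insert k J. a i * a j * V i j) =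
      (\<Sum>i\<in>J. \<Sum>j\<in>J. (a i + a k * c i) * (a j + a k * c j) * V i j)
      + (a k)\<^sup>2 * (V k k - (\<Sum>j\<in>J. V k j * c j))"
proof -
  have sym: "V i j = V j i" if "i \<in> insert k J" "j \<in> insert k J" for i j
    using V that by (auto simp: posdef_on_def)
  have cc: "(\<Sum>i\<in>J. \<Sum>j\<in>J. f i * c j * V i j) = (\<Sum>i\<in>J. f i * V k i)" for f
    by (intro sum.cong refl) (auto simp: c[symmetric] sym[of k] sum_distrib_left mult_ac)
  have cc': "(\<Sum>i\<in>J. \<Sum>j\<in>J. c i * f j * V i j) = (\<Sum>i\<in>J. f i * V k i)" for f
    using cc[of f] sym by (subst sum.swap) (auto simp: mult_ac cong: sum.cong)
  have *: "(\<Sum>i\<in>J. \<Sum>j\<in>J. (a i + s * c i) * (a j + s * c j) * V i j) =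
     (\<Sum>i\<in>J. \<Sum>j\<in>J. a i * a j * V i j) + 2 * s * (\<Sum>i\<in>J. a i * V k i) + s\<^sup>2 * (\<Sum>j\<in>J. V k j * c j)" for a s
  proof -
    have "(\<Sum>i\<in>J. \<Sum>j\<in>J. (a i + s * c i) * (a j + s * c j) * V i j) =
      (\<Sum>i\<in>J. \<Sum>j\<in>J. a i * a j * V i j + s * (a i * c j * V i j) + s * (c i * a j * V i j)
        + s\<^sup>2 * (c i * c j * V i j))"
      by (intro sum.cong refl) (simp add: algebra_simps power2_eq_square)
    also have "\<dots> = (\<Sum>i\<in>J. \<Sum>j\<in>J. a i * a j * V i j) + s * (\<Sum>i\<in>J. \<Sum>j\<in>J. a i * c j * V i j)
        + s * (\<Sum>i\<in>J. \<Sum>j\<in>J. c i * a j * V i j) + s\<^sup>2 * (\<Sum>i\<in>J. \<Sum>j\<in>J. c i * c j * V i j)"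
      by (simp only: sum.distrib sum_distrib_left)
    finally show ?thesis by (simp add: cc cc') (simp add: mult.commute)
  qed
  show E: "(\<Sum>i\<in>insert k J. \<Sum>j\<in>insert k J. a i * a j * V i j) =
      (\<Sum>i\<in>J. \<Sum>j\<in>J. (a i + a k * c i) * (a j + a k * c j) * V i j)
      + (a k)\<^sup>2 * (V k k - (\<Sum>j\<in>J. V k j * c j))" for a
    unfolding * by (subst quadratic_form_insert[OF J]) (auto simp: sym algebra_simps)
  define b where "b j = (if j = k then 1 else - c j)" for j
  have "(\<Sum>i\<in>insert k J. \<Sum>j\<in>insert k J. b i * b j * V i j) > 0"
    using V unfolding posdef_on_def by (auto simp: b_def intro!: bexI[of _ k])
  also have "(\<Sum>i\<in>insert k J. \<Sum>j\<in>insert k J. b i * b j * V i j) = V k k - (\<Sum>j\<in>J. V k j * c j)"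
  proof -
    have "b i + b k * c i = 0" if "i \<in> J" for i using that J by (auto simp: b_def)
    then show ?thesis unfolding E by (simp add: b_def)
  qed
  finally show "V k k - (\<Sum>j\<in>J. V k j * c j) > 0" .
qed

text \<open>Block elimination takes the place of an inverse matrix. For every \<open>x\<close> the
  vector \<open>z - x * c\<close>, extended by the value \<open>x\<close> at \<open>k\<close>,
  solves the equations with index in \<open>J\<close>; equation \<open>k\<close> then determines
  \<open>x\<close>, because its coefficient is the positive Schur complement
  \<open>s\<close>.\<close>

lemma posdef_on_solvable:
  assumes "finite J" "posdef_on J V"
  shows "\<exists>c. \<forall>i\<in>J. (\<Sum>j\<in>J. V i j * c j) = b i"
  using assms
proof (induction J arbitrary: b rule: finite_induct)
  case empty
  then show ?case by simp
next
  case (insert k J)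
  have V: "posdef_on J V" using posdef_on_subset[OF insert.prems] insert.hyps by auto
  obtain c where c: "\<And>i. i \<in> J \<Longrightarrow> (\<Sum>j\<in>J. V i j * c j) = V i k"
    using insert.IH[OF V, of "\<lambda>i. V i k"] by auto
  obtain z where z: "\<And>i. i \<in> J \<Longrightarrow> (\<Sum>j\<in>J. V i j * z j) = b i"
    using insert.IH[OF V, of b] by auto
  define s where "s = V k k - (\<Sum>j\<in>J. V k j * c j)"
  have s: "s > 0" unfolding s_def by (rule schur_complement(1)[OF insert.hyps insert.prems c])
  define x where "x = (b k - (\<Sum>j\<in>J. V k j * z j)) / s"
  define d where "d j = (if j = k then x else z j - x * c j)" for j
  have d: "(\<Sum>j\<in>insert k J. V i j * d j) = V i k * x + (\<Sum>j\<in>J. V i j * z j) - x * (\<Sum>j\<in>J. V i j * c j)" for i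
  proof -
    have "(\<Sum>j\<in>J. V i j * d j) = (\<Sum>j\<in>J. V i j * z j - x * (V i j * c j))"
      using insert.hyps by (intro sum.cong) (auto simp: d_def algebra_simps)
    then show ?thesis using insert.hyps by (simp add: sum_subtractf sum_distrib_left d_def)
  qed
  have "(\<Sum>j\<in>insert k J. V i j * d j) = b i" if "i \<in> insert k J" for i
  proof (cases "i = k")
    case True
    have "x * s = b k - (\<Sum>j\<in>J. V k j * z j)" using s by (simp add: x_def)
    then show ?thesis unfolding d True by (simp add: s_def algebra_simps)
  next
    case False
    then show ?thesis using that unfolding d by (simp add: c z)
  qed
  then show ?case by blast
qed

section \<open>Gaussian densities built by successive conditioning\<close>

lemma integral_normal_density_iexp:
  assumes "s > 0"
  shows "(\<integral>y. normal_density m s y *\<^sub>R iexp (t * y) \<partial>lborel) = iexp (t * m) * of_real (exp (- (t * s)\<^sup>2 / 2))"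
proof -
  have "(\<integral>y. normal_density m s y *\<^sub>R iexp (t * y) \<partial>lborel) =
      \<bar>s\<bar> *\<^sub>R (\<integral>x. normal_density m s (m + s * x) *\<^sub>R iexp (t * (m + s * x)) \<partial>lborel)"
    using assms by (intro lborel_integral_real_affine) auto
  also have "\<dots> = (\<integral>x. s *\<^sub>R (normal_density m s (m + s * x) *\<^sub>R iexp (t * (m + s * x))) \<partial>lborel)"
    unfolding integral_scaleR_right using assms by simp
  also have "\<dots> = (\<integral>x. iexp (t * m) * (std_normal_density x *\<^sub>R iexp ((t * s) * x)) \<partial>lborel)"
  proof (intro Bochner_Integration.integral_cong refl)
    fix x
    have "s * normal_density m s (m + s * x) = std_normal_density x"
      using assms by (simp add: normal_density_def real_sqrt_mult power_mult_distrib)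
    moreover have "iexp (t * (m + s * x)) = iexp (t * m) * iexp ((t * s) * x)"
      by (simp add: exp_add[symmetric] algebra_simps)
    ultimately show "s *\<^sub>R (normal_density m s (m + s * x) *\<^sub>R iexp (t * (m + s * x))) =
      iexp (t * m) * (std_normal_density x *\<^sub>R iexp ((t * s) * x))"
      by (simp add: scaleR_scaleR[symmetric] del: scaleR_scaleR) (simp add: mult_ac)
  qed
  also have "\<dots> = iexp (t * m) * char std_normal_distribution (t * s)"
    unfolding char_def integral_mult_right_zero by (subst integral_density) auto
  finally show ?thesis by (simp add: char_std_normal_distribution)
qed

text \<open>Logarithms of non-degenerate Gaussian densities have this form. One square per index
  corresponds to a triangular factorisation of the inverse covariance matrix, which the construction
  below produces row by row.\<close>

definition quadratic_log :: "'i set \<Rightarrow> (('i \<Rightarrow> real) \<Rightarrow> real) \<Rightarrow> bool" where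
  "quadratic_log J q \<longleftrightarrow> (\<exists>C \<beta> A. \<forall>y. q y = C - (\<Sum>k\<in>J. (\<beta> k + (\<Sum>j\<in>J. A k j * y j))\<^sup>2))"

lemma quadratic_log_measurable:
  assumes "quadratic_log J q" "sets M = sets (PiM J (\<lambda>_. lborel))"
  shows "q \<in> borel_measurable M"
proof -
  note [measurable_cong] = assms(2)
  from assms(1) obtain C \<beta> A where "\<forall>y. q y = C - (\<Sum>k\<in>J. (\<beta> k + (\<Sum>j\<in>J. A k j * y j))\<^sup>2)"
    unfolding quadratic_log_def by blast
  then have q: "q = (\<lambda>y. C - (\<Sum>k\<in>J. (\<beta> k + (\<Sum>j\<in>J. A k j * y j))\<^sup>2))" by blast
  show ?thesis unfolding q by measurable
qed

text \<open>Given the coordinates in \<open>J\<close>, coordinate \<open>k\<close> is taken normal;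
  its mean is the affine regression on \<open>J\<close> and its variance the Schur complement. The
  product of the old density with this conditional density again has a quadratic logarithm, and mass
  and characteristic function follow by integrating out coordinate \<open>k\<close> first.\<close>

theorem gaussian_density_exists:
  fixes V :: "'i \<Rightarrow> 'i \<Rightarrow> real" and m :: "'i \<Rightarrow> real"
  assumes "finite J" "posdef_on J V"
  shows "\<exists>q. quadratic_log J q \<and> prob_space (density (PiM J (\<lambda>_. lborel)) (\<lambda>y. ennreal (exp (q y)))) \<and>
    (\<forall>a. (\<integral>y. exp (q y) *\<^sub>R iexp (\<Sum>j\<in>J. a j * y j) \<partial>PiM J (\<lambda>_. lborel)) =
       iexp (\<Sum>j\<in>J. a j * m j) * of_real (exp (- (\<Sum>i\<in>J. \<Sum>j\<in>J. a i * a j * V i j) / 2)))"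
  using assms
proof (induction J rule: finite_induct)
  case empty
  interpret product_sigma_finite "\<lambda>_. lborel :: real measure" ..
  have "prob_space (density (PiM {} (\<lambda>_. lborel)) (\<lambda>y::'i \<Rightarrow> real. ennreal (exp 0)))"
    by standard (simp add: density_1 one_ennreal_def[symmetric] PiM_empty)
  then show ?case
    by (intro exI[of _ "\<lambda>_. 0"]) (auto simp: quadratic_log_def PiM_empty)
next
  case (insert k J)
  interpret product_sigma_finite "\<lambda>_. lborel :: real measure" ..
  let ?L = "\<lambda>J. PiM J (\<lambda>_::'i. lborel :: real measure)"
  have V: "posdef_on J V" using posdef_on_subset[OF insert.prems] insert.hyps by auto
  obtain q where q: "quadratic_log J q" and pq: "prob_space (density (?L J) (\<lambda>y. ennreal (exp (q y))))"
    and cq: "\<And>a. (\<integral>y. exp (q y) *\<^sub>R iexp (\<Sum>j\<in>J. a j * y j) \<partial>?L J) =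
       iexp (\<Sum>j\<in>J. a j * m j) * of_real (exp (- (\<Sum>i\<in>J. \<Sum>j\<in>J. a i * a j * V i j) / 2))"
    using insert.IH[OF V] by auto
  obtain c where c: "\<And>i. i \<in> J \<Longrightarrow> (\<Sum>j\<in>J. V i j * c j) = V i k"
    using posdef_on_solvable[OF insert.hyps(1) V, of "\<lambda>i. V i k"] by auto
  define v where "v = V k k - (\<Sum>j\<in>J. V k j * c j)"
  have v: "v > 0" unfolding v_def by (rule schur_complement(1)[OF insert.hyps insert.prems c])
  define s where "s = sqrt v"
  have s: "s > 0" "s\<^sup>2 = v" using v by (auto simp: s_def)
  \<comment> \<open>the conditional mean of coordinate \<open>k\<close> given the coordinates in \<open>J\<close>\<close>
  define l where "l y = m k + (\<Sum>j\<in>J. c j * (y j - m j))" for y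
  define r where "r y = q y + ln (normal_density (l y) s (y k))" for y
  have er: "exp (r y) = exp (q y) * normal_density (l y) s (y k)" for y
    using normal_density_pos[OF s(1)] by (simp add: r_def exp_add)
  have [measurable]: "q \<in> borel_measurable (?L J)"
    by (rule quadratic_log_measurable[OF q refl])
  obtain C \<beta> A where qq: "\<And>y. q y = C - (\<Sum>k\<in>J. (\<beta> k + (\<Sum>j\<in>J. A k j * y j))\<^sup>2)"
    using q by (auto simp: quadratic_log_def)
  have upd: "q (y(k := u)) = q y" "l (y(k := u)) = l y" for y u
  proof -
    have "(\<Sum>j\<in>J. f j * (y(k := u)) j) = (\<Sum>j\<in>J. f j * y j)" for f
      using insert.hyps by (intro sum.cong) auto
    then show "q (y(k := u)) = q y" by (simp add: qq)
    show "l (y(k := u)) = l y" using insert.hyps by (auto simp: l_def intro!: sum.cong)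
  qed
  have Q: "quadratic_log (insert k J) r"
  proof -
    \<comment> \<open>Row \<open>k\<close> of the enlarged form is the scaled residual
      \<open>(y k - l y) / (sqrt 2 * s)\<close>, whose square is, up to sign, the exponent of the
      conditional normal density. The old rows get coefficient 0 in the new column.\<close>
    define \<beta>' where "\<beta>' i = (if i = k then (- m k + (\<Sum>j\<in>J. c j * m j)) / (sqrt 2 * s) else \<beta> i)" for i
    define A' where "A' i j = (if i = k then (if j = k then 1 else - c j) / (sqrt 2 * s)
       else if j = k then 0 else A i j)" for i j
    have "r y = C - ln (sqrt (2 * pi * s\<^sup>2)) - (\<Sum>i\<in>insert k J. (\<beta>' i + (\<Sum>j\<in>insert k J. A' i j * y j))\<^sup>2)" for y
    proof -
      have old: "(\<Sum>i\<in>J. (\<beta>' i + (\<Sum>j\<in>insert k J. A' i j * y j))\<^sup>2) = (\<Sum>i\<in>J. (\<beta> i + (\<Sum>j\<in>J. A i j * y j))\<^sup>2)"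
      proof (intro sum.cong refl)
        fix i assume "i \<in> J"
        then have "i \<noteq> k" using insert.hyps by auto
        moreover have "(\<Sum>j\<in>J. A' i j * y j) = (\<Sum>j\<in>J. A i j * y j)"
          using insert.hyps \<open>i \<noteq> k\<close> by (intro sum.cong) (auto simp: A'_def)
        ultimately show "(\<beta>' i + (\<Sum>j\<in>insert k J. A' i j * y j))\<^sup>2 = (\<beta> i + (\<Sum>j\<in>J. A i j * y j))\<^sup>2"
          using insert.hyps by (simp add: \<beta>'_def A'_def)
      qed
      have "(\<Sum>j\<in>J. A' k j * y j) = - (\<Sum>j\<in>J. c j * y j) / (sqrt 2 * s)"
        unfolding sum_negf[symmetric] sum_divide_distrib
        using insert.hyps by (intro sum.cong) (auto simp: A'_def)
      moreover have "\<beta>' k = (- m k + (\<Sum>j\<in>J. c j * m j)) / (sqrt 2 * s)" "A' k k = 1 / (sqrt 2 * s)"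
        by (auto simp: \<beta>'_def A'_def)
      ultimately have "\<beta>' k + (\<Sum>j\<in>insert k J. A' k j * y j) = (y k - l y) / (sqrt 2 * s)"
        unfolding sum.insert[OF insert.hyps(1,2)]
        by (simp add: l_def right_diff_distrib sum_subtractf add_divide_distrib diff_divide_distrib)
      then have new: "(\<beta>' k + (\<Sum>j\<in>insert k J. A' k j * y j))\<^sup>2 = (y k - l y)\<^sup>2 / (2 * s\<^sup>2)"
        by (simp add: power_divide power_mult_distrib)
      have "ln (normal_density (l y) s (y k)) = - ln (sqrt (2 * pi * s\<^sup>2)) - (y k - l y)\<^sup>2 / (2 * s\<^sup>2)"
        using s(1) unfolding normal_density_def by (subst ln_mult) (auto simp: ln_div)
      then show ?thesis
        using old new sum.insert[OF insert.hyps(1,2), of "\<lambda>i. (\<beta>' i + (\<Sum>j\<in>insert k J. A' i j * y j))\<^sup>2"]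
        unfolding r_def qq by linarith
    qed
    then show ?thesis unfolding quadratic_log_def by blast
  qed
  have [measurable]: "r \<in> borel_measurable (?L (insert k J))"
    by (rule quadratic_log_measurable[OF Q refl])
  have nn: "(\<integral>\<^sup>+y. ennreal (exp (r y)) \<partial>?L (insert k J)) = 1"
  proof -
    have "(\<integral>\<^sup>+y. ennreal (exp (r y)) \<partial>?L (insert k J)) =
        (\<integral>\<^sup>+y. \<integral>\<^sup>+u. ennreal (exp (r (y(k := u)))) \<partial>lborel \<partial>?L J)"
      using insert.hyps by (intro product_nn_integral_insert) auto
    also have "\<dots> = (\<integral>\<^sup>+y. \<integral>\<^sup>+u. ennreal (exp (q y)) * ennreal (normal_density (l y) s u) \<partial>lborel \<partial>?L J)"
      by (intro nn_integral_cong) (simp add: er upd ennreal_mult')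
    also have "\<dots> = (\<integral>\<^sup>+y. ennreal (exp (q y)) \<partial>?L J)"
      using s by (simp add: nn_integral_cmult nn_integral_eq_integral)
    also have "\<dots> = 1"
      using prob_space.emeasure_space_1[OF pq] by (simp add: emeasure_density cong: nn_integral_cong)
    finally show ?thesis .
  qed
  have P: "prob_space (density (?L (insert k J)) (\<lambda>y. ennreal (exp (r y))))"
    by standard (simp add: emeasure_density nn cong: nn_integral_cong)
  have int: "integrable (?L (insert k J)) (\<lambda>y. exp (r y))"
    using nn by (intro integrableI_nonneg) auto
  have "(\<integral>y. exp (r y) *\<^sub>R iexp (\<Sum>j\<in>insert k J. a j * y j) \<partial>?L (insert k J)) =
       iexp (\<Sum>j\<in>insert k J. a j * m j) *
       of_real (exp (- (\<Sum>i\<in>insert k J. \<Sum>j\<in>insert k J. a i * a j * V i j) / 2))" for a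
  proof -
    have int': "integrable (?L (insert k J)) (\<lambda>y. exp (r y) *\<^sub>R iexp (\<Sum>j\<in>insert k J. a j * y j))"
      by (rule Bochner_Integration.integrable_bound[OF int]) auto
    \<comment> \<open>Integrating out \<open>u\<close> replaces it by its conditional mean
      \<open>l y\<close> and adds a Gaussian factor. The part of \<open>a k * l y\<close> that is
      linear in \<open>y\<close> changes the frequencies on \<open>J\<close> from \<open>a\<close>
      to \<open>b\<close>; \<open>e\<close> collects what does not depend on
      \<open>y\<close>.\<close>
    define b where "b j = a j + a k * c j" for j
    define e where "e = iexp (a k * (m k - (\<Sum>j\<in>J. c j * m j))) * of_real (exp (- (a k * s)\<^sup>2 / 2))"
    have "(\<integral>y. exp (r y) *\<^sub>R iexp (\<Sum>j\<in>insert k J. a j * y j) \<partial>?L (insert k J)) =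
      (\<integral>y. \<integral>u. exp (r (y(k := u))) *\<^sub>R iexp (\<Sum>j\<in>insert k J. a j * (y(k := u)) j) \<partial>lborel \<partial>?L J)"
      using insert.hyps int' by (intro product_integral_insert) auto
    also have "\<dots> = (\<integral>y. (exp (q y) *\<^sub>R iexp (\<Sum>j\<in>J. b j * y j)) * e \<partial>?L J)"
    proof (intro Bochner_Integration.integral_cong refl)
      fix y
      have sm: "(\<Sum>j\<in>insert k J. a j * (y(k := u)) j) = a k * u + (\<Sum>j\<in>J. a j * y j)" for u
        using insert.hyps by (auto intro!: sum.cong)
      have "(\<integral>u. exp (r (y(k := u))) *\<^sub>R iexp (\<Sum>j\<in>insert k J. a j * (y(k := u)) j) \<partial>lborel) =
        (\<integral>u. (exp (q y) *\<^sub>R iexp (\<Sum>j\<in>J. a j * y j)) * (normal_density (l y) s u *\<^sub>R iexp (a k * u)) \<partial>lborel)"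
        unfolding sm er upd
        by (intro Bochner_Integration.integral_cong refl) (simp add: scaleR_conv_of_real exp_add ring_distribs mult_ac)
      also have "\<dots> = (exp (q y) *\<^sub>R iexp (\<Sum>j\<in>J. a j * y j)) * (iexp (a k * l y) * of_real (exp (- (a k * s)\<^sup>2 / 2)))"
        by (subst integral_mult_right_zero) (simp only: integral_normal_density_iexp[OF s(1)])
      also have "\<dots> = (exp (q y) *\<^sub>R iexp (\<Sum>j\<in>J. b j * y j)) * e"
      proof -
        have "(\<Sum>j\<in>J. a j * y j) + a k * l y = (\<Sum>j\<in>J. b j * y j) + a k * (m k - (\<Sum>j\<in>J. c j * m j))"
          by (simp add: b_def l_def algebra_simps sum.distrib sum_subtractf sum_distrib_left)
        then have "iexp (\<Sum>j\<in>J. a j * y j) * iexp (a k * l y) =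
          iexp (\<Sum>j\<in>J. b j * y j) * iexp (a k * (m k - (\<Sum>j\<in>J. c j * m j)))"
          by (simp only: exp_add[symmetric] distrib_left[symmetric] of_real_add[symmetric])
        then show ?thesis by (simp add: e_def scaleR_conv_of_real mult_ac)
      qed
      finally show "(\<integral>u. exp (r (y(k := u))) *\<^sub>R iexp (\<Sum>j\<in>insert k J. a j * (y(k := u)) j) \<partial>lborel) =
        (exp (q y) *\<^sub>R iexp (\<Sum>j\<in>J. b j * y j)) * e" .
    qed
    also have "\<dots> = iexp (\<Sum>j\<in>J. b j * m j) * of_real (exp (- (\<Sum>i\<in>J. \<Sum>j\<in>J. b i * b j * V i j) / 2)) * e"
      by (subst integral_mult_left_zero) (simp only: cq)
    also have "\<dots> = iexp (\<Sum>j\<in>insert k J. a j * m j) *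
       of_real (exp (- (\<Sum>i\<in>insert k J. \<Sum>j\<in>insert k J. a i * a j * V i j) / 2))"
    proof -
      have 1: "(\<Sum>j\<in>insert k J. a j * m j) = (\<Sum>j\<in>J. b j * m j) + a k * (m k - (\<Sum>j\<in>J. c j * m j))"
        using insert.hyps by (simp add: b_def algebra_simps sum.distrib sum_distrib_left)
      \<comment> \<open>The Schur decomposition splits the variance of the functional
        \<open>a\<close> into the part explained by \<open>J\<close>, which is the form at
        \<open>b\<close>, and the residual part contributed by \<open>e\<close>.\<close>
      have 2: "- (\<Sum>i\<in>insert k J. \<Sum>j\<in>insert k J. a i * a j * V i j) / 2 =
          - (\<Sum>i\<in>J. \<Sum>j\<in>J. b i * b j * V i j) / 2 + - (a k * s)\<^sup>2 / 2"
        using schur_complement(2)[OF insert.hyps insert.prems c, of a]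
        unfolding power_mult_distrib s(2) v_def[symmetric] b_def[symmetric] by linarith
      show ?thesis unfolding 1 2 e_def of_real_add distrib_left exp_add of_real_mult by (simp only: mult_ac)
    qed
    finally show ?thesis .
  qed
  then show ?case using Q P by blast
qed

section \<open>Gaussian laws and their moments\<close>

lemma integrable_product_of_squares:
  fixes f g :: "'a \<Rightarrow> real"
  assumes [measurable]: "f \<in> borel_measurable M" "g \<in> borel_measurable M"
    and "integrable M (\<lambda>x. (f x)\<^sup>2)" "integrable M (\<lambda>x. (g x)\<^sup>2)"
  shows "integrable M (\<lambda>x. f x * g x)"
proof (rule Bochner_Integration.integrable_bound)
  show "integrable M (\<lambda>x. (f x)\<^sup>2 + (g x)\<^sup>2)" using assms by auto
  have "\<bar>a * b\<bar> \<le> a\<^sup>2 + b\<^sup>2" for a b :: real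
  proof -
    have "2 * \<bar>a\<bar> * \<bar>b\<bar> \<le> a\<^sup>2 + b\<^sup>2" using sum_squares_bound[of "\<bar>a\<bar>" "\<bar>b\<bar>"] by simp
    moreover have "0 \<le> \<bar>a\<bar> * \<bar>b\<bar>" by simp
    ultimately show ?thesis unfolding abs_mult by linarith
  qed
  then show "AE x in M. norm (f x * g x) \<le> norm ((f x)\<^sup>2 + (g x)\<^sup>2)" by simp
qed measurable

lemma affine_square_moment:
  fixes P :: "('i \<Rightarrow> real) measure"
  assumes J: "finite J" and "prob_space P"
    and meas: "\<And>j. j \<in> J \<Longrightarrow> (\<lambda>y. y j) \<in> borel_measurable P"
    and sq: "\<And>j. j \<in> J \<Longrightarrow> integrable P (\<lambda>y. (y j)\<^sup>2)"
  shows "integrable P (\<lambda>y. (\<beta> + (\<Sum>j\<in>J. a j * y j))\<^sup>2)"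
    and "(\<integral>y. (\<beta> + (\<Sum>j\<in>J. a j * y j))\<^sup>2 \<partial>P) =
      (\<Sum>i\<in>J. \<Sum>j\<in>J. a i * a j * (\<integral>y. (y i - (\<integral>x. x i \<partial>P)) * (y j - (\<integral>x. x j \<partial>P)) \<partial>P))
      + (\<beta> + (\<Sum>j\<in>J. a j * (\<integral>x. x j \<partial>P)))\<^sup>2"
    and "(\<integral>y. (\<Sum>j\<in>J. a j * y j) \<partial>P) = (\<Sum>j\<in>J. a j * (\<integral>x. x j \<partial>P))"
proof -
  interpret prob_space P by fact
  define m where "m j = (\<integral>x. x j \<partial>P)" for j
  have i1: "integrable P (\<lambda>y. y j)" if "j \<in> J" for j
    using square_integrable_imp_integrable[OF meas sq] that by auto
  have iz: "integrable P (\<lambda>y. y j - m j)" and ez: "(\<integral>y. y j - m j \<partial>P) = 0" if "j \<in> J" for j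
    using i1[OF that] by (auto simp: m_def prob_space)
  have i2: "integrable P (\<lambda>y. (y i - m i) * (y j - m j))" if "i \<in> J" "j \<in> J" for i j
  proof (rule integrable_product_of_squares)
    show "integrable P (\<lambda>y. (y i - m i)\<^sup>2)" "integrable P (\<lambda>y. (y j - m j)\<^sup>2)"
      using sq i1 that by (auto simp: power2_diff)
  qed (use that meas in auto)
  \<comment> \<open>\<open>B\<close> is the expectation of the affine function. Expanding around it
    leaves only centred coordinates, so the mixed term integrates to 0.\<close>
  define B where "B = \<beta> + (\<Sum>j\<in>J. a j * m j)"
  have E: "(\<beta> + (\<Sum>j\<in>J. a j * y j))\<^sup>2 =
     B\<^sup>2 + 2 * B * (\<Sum>j\<in>J. a j * (y j - m j)) + (\<Sum>i\<in>J. \<Sum>j\<in>J. a i * a j * ((y i - m i) * (y j - m j)))" for y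
  proof -
    have "\<beta> + (\<Sum>j\<in>J. a j * y j) = B + (\<Sum>j\<in>J. a j * (y j - m j))"
      by (simp add: B_def right_diff_distrib sum_subtractf)
    moreover have "(\<Sum>j\<in>J. a j * (y j - m j))\<^sup>2 = (\<Sum>i\<in>J. \<Sum>j\<in>J. a i * a j * ((y i - m i) * (y j - m j)))"
      unfolding power2_eq_square sum_product by (simp add: mult_ac)
    ultimately show ?thesis by (simp add: power2_sum)
  qed
  have I1: "integrable P (\<lambda>y. \<Sum>j\<in>J. a j * (y j - m j))"
    using iz by (intro Bochner_Integration.integrable_sum integrable_mult_right) auto
  have I2: "integrable P (\<lambda>y. \<Sum>i\<in>J. \<Sum>j\<in>J. a i * a j * ((y i - m i) * (y j - m j)))"
    using i2 by (intro Bochner_Integration.integrable_sum integrable_mult_right) auto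
  show "integrable P (\<lambda>y. (\<beta> + (\<Sum>j\<in>J. a j * y j))\<^sup>2)"
    unfolding E using I1 I2 by (intro Bochner_Integration.integrable_add integrable_mult_right) auto
  have z1: "(\<integral>y. (\<Sum>j\<in>J. a j * (y j - m j)) \<partial>P) = 0"
    using iz ez by (subst Bochner_Integration.integral_sum) auto
  have z2: "(\<integral>y. (\<Sum>i\<in>J. \<Sum>j\<in>J. a i * a j * ((y i - m i) * (y j - m j))) \<partial>P) =
     (\<Sum>i\<in>J. \<Sum>j\<in>J. a i * a j * (\<integral>y. (y i - m i) * (y j - m j) \<partial>P))"
    using i2 by (subst Bochner_Integration.integral_sum, auto intro!: sum.cong)+
  have "(\<integral>y. (\<beta> + (\<Sum>j\<in>J. a j * y j))\<^sup>2 \<partial>P) =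
     (\<integral>y. B\<^sup>2 + 2 * B * (\<Sum>j\<in>J. a j * (y j - m j)) \<partial>P)
     + (\<integral>y. (\<Sum>i\<in>J. \<Sum>j\<in>J. a i * a j * ((y i - m i) * (y j - m j))) \<partial>P)"
    unfolding E using I1 I2 by (intro Bochner_Integration.integral_add) auto
  also have "(\<integral>y. B\<^sup>2 + 2 * B * (\<Sum>j\<in>J. a j * (y j - m j)) \<partial>P) = B\<^sup>2"
    using I1 z1 by (subst Bochner_Integration.integral_add) (auto simp: prob_space simp del: sum.cong)
  finally show "(\<integral>y. (\<beta> + (\<Sum>j\<in>J. a j * y j))\<^sup>2 \<partial>P) =
      (\<Sum>i\<in>J. \<Sum>j\<in>J. a i * a j * (\<integral>y. (y i - (\<integral>x. x i \<partial>P)) * (y j - (\<integral>x. x j \<partial>P)) \<partial>P))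
      + (\<beta> + (\<Sum>j\<in>J. a j * (\<integral>x. x j \<partial>P)))\<^sup>2"
    unfolding z2 unfolding B_def m_def by simp
  show "(\<integral>y. (\<Sum>j\<in>J. a j * y j) \<partial>P) = (\<Sum>j\<in>J. a j * (\<integral>x. x j \<partial>P))"
    using i1 by (subst Bochner_Integration.integral_sum) auto
qed

text \<open>Names the disjunction in \<open>gaussian_Rn\<close>. Counting a point mass as \<sigma> =
  0 lets mean, variance and characteristic function keep one formula in both cases.\<close>

definition normal_law :: "real measure \<Rightarrow> real \<Rightarrow> real \<Rightarrow> bool" where
  "normal_law D m \<sigma> \<longleftrightarrow> (\<sigma> = 0 \<and> D = return lborel m) \<or>
     (\<sigma> > 0 \<and> D = density lborel (\<lambda>t. ennreal (normal_density m \<sigma> t)))"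

lemma normal_law_moments:
  assumes "normal_law D m \<sigma>"
  shows "integrable D (\<lambda>t. t\<^sup>2)" "(\<integral>t. t \<partial>D) = m" "(\<integral>t. (t - m)\<^sup>2 \<partial>D) = \<sigma>\<^sup>2"
    "(\<integral>t. iexp (s * t) \<partial>D) = iexp (s * m) * of_real (exp (- (s * \<sigma>)\<^sup>2 / 2))"
    "real_distribution D"
proof -
  have "integrable D (\<lambda>t. t\<^sup>2) \<and> (\<integral>t. t \<partial>D) = m \<and> (\<integral>t. (t - m)\<^sup>2 \<partial>D) = \<sigma>\<^sup>2 \<and>
    (\<integral>t. iexp (s * t) \<partial>D) = iexp (s * m) * of_real (exp (- (s * \<sigma>)\<^sup>2 / 2)) \<and> real_distribution D"
    using assms unfolding normal_law_def
  proof (elim disjE conjE)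
    assume *: "\<sigma> = 0" "D = return lborel m"
    have "prob_space D" unfolding * by (intro prob_space_return) simp
    then have "real_distribution D"
      unfolding real_distribution_def real_distribution_axioms_def by (simp add: *)
    moreover have "integrable D (\<lambda>t. t\<^sup>2)"
    proof (rule integrableI_bounded)
      show "(\<integral>\<^sup>+ t. ennreal (norm (t\<^sup>2)) \<partial>D) < \<infinity>"
        unfolding * by (subst nn_integral_return) auto
    qed (simp add: *)
    ultimately show ?thesis by (simp add: * integral_return)
  next
    assume s: "\<sigma> > 0" and D: "D = density lborel (\<lambda>t. ennreal (normal_density m \<sigma> t))"
    have "prob_space D" unfolding D by (rule prob_space_normal_density[OF s])
    then have "real_distribution D"
      unfolding real_distribution_def real_distribution_axioms_def by (simp add: D)
    moreover have "integrable D (\<lambda>t. t\<^sup>2)"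
    proof -
      have "normal_density m \<sigma> t * t\<^sup>2 = normal_density m \<sigma> t * (t - m)^2
          + 2 * m * (normal_density m \<sigma> t * t) - m\<^sup>2 * normal_density m \<sigma> t" for t
        by (simp add: algebra_simps power2_eq_square)
      then show ?thesis unfolding D
        using integrable_normal_moment[OF s, of m 2] integrable_normal_moment_nz_1[OF s, of m] s
        by (subst integrable_density) auto
    qed
    moreover have "(\<integral>t. t \<partial>D) = m"
      unfolding D by (subst integral_density) (auto simp: integral_normal_moment_nz_1[OF s])
    moreover have "(\<integral>t. (t - m)\<^sup>2 \<partial>D) = \<sigma>\<^sup>2"
      unfolding D using integral_normal_moment_even[OF s, of m 1]
      by (subst integral_density) (auto simp: power2_eq_square fact_numeral)
    moreover have "(\<integral>t. iexp (s * t) \<partial>D) = iexp (s * m) * of_real (exp (- (s * \<sigma>)\<^sup>2 / 2))"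
      unfolding D integral_normal_density_iexp[OF s, symmetric] by (subst integral_density) auto
    ultimately show ?thesis by blast
  qed
  then show "integrable D (\<lambda>t. t\<^sup>2)" "(\<integral>t. t \<partial>D) = m" "(\<integral>t. (t - m)\<^sup>2 \<partial>D) = \<sigma>\<^sup>2"
    "(\<integral>t. iexp (s * t) \<partial>D) = iexp (s * m) * of_real (exp (- (s * \<sigma>)\<^sup>2 / 2))"
    "real_distribution D" by auto
qed

section \<open>Identification of Gaussian laws on R^n\<close>

lemma measurable_coordinate_Rn:
  "sets P = sets (Rn n) \<Longrightarrow> i < n \<Longrightarrow> (\<lambda>y. y i) \<in> borel_measurable P"
  by (simp add: Rn_def cong: measurable_cong_sets)

lemma measurable_linear_Rn:
  "sets P = sets (Rn n) \<Longrightarrow> (\<lambda>y. \<Sum>i<n. a i * y i) \<in> borel_measurable P"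
  by (intro borel_measurable_sum borel_measurable_times) (auto intro: measurable_coordinate_Rn)

lemma quadratic_form_cov_mat_eq_variance:
  assumes "is_prob_Rn n P" "\<And>i. i < n \<Longrightarrow> integrable P (\<lambda>y. (y i)\<^sup>2)"
  shows "(\<Sum>i<n. \<Sum>j<n. a i * a j * cov_mat P i j) = (\<integral>y. ((\<Sum>i<n. a i * y i) - (\<Sum>i<n. a i * mean_vec P i))\<^sup>2 \<partial>P)"
    and "integrable P (\<lambda>y. ((\<Sum>i<n. a i * y i) - (\<Sum>i<n. a i * mean_vec P i))\<^sup>2)"
proof -
  have P: "prob_space P" "sets P = sets (Rn n)" using assms(1) by (auto simp: is_prob_Rn_def)
  note * = affine_square_moment(1-2)[where J="{..<n}" and P=P and \<beta>="- (\<Sum>i<n. a i * mean_vec P i)" and a=a]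
  show "(\<Sum>i<n. \<Sum>j<n. a i * a j * cov_mat P i j) = (\<integral>y. ((\<Sum>i<n. a i * y i) - (\<Sum>i<n. a i * mean_vec P i))\<^sup>2 \<partial>P)"
    using *(2)[OF _ P(1)] assms(2) measurable_coordinate_Rn[OF P(2)]
    by (simp add: cov_mat_def mean_vec_def)
  show "integrable P (\<lambda>y. ((\<Sum>i<n. a i * y i) - (\<Sum>i<n. a i * mean_vec P i))\<^sup>2)"
    using *(1)[OF _ P(1)] assms(2) measurable_coordinate_Rn[OF P(2)] by simp
qed

lemma gaussian_Rn_square_integrable:
  assumes "gaussian_Rn n P" "i < n"
  shows "integrable P (\<lambda>y. (y i)\<^sup>2)"
proof -
  have P: "prob_space P" "sets P = sets (Rn n)" using assms(1) by (auto simp: gaussian_Rn_def is_prob_Rn_def)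
  define a where "a j = (if j = i then 1 else 0 :: real)" for j
  have eq: "(\<Sum>j<n. a j * y j) = y i" for y
  proof -
    have "(\<Sum>j<n. a j * y j) = (\<Sum>j<n. if j = i then y j else 0)" by (intro sum.cong) (auto simp: a_def)
    then show ?thesis using assms(2) by simp
  qed
  obtain m \<sigma> where "normal_law (distr P lborel (\<lambda>y. \<Sum>j<n. a j * y j)) m \<sigma>"
    using assms(1) unfolding gaussian_Rn_def normal_law_def by blast
  from normal_law_moments(1)[OF this] show ?thesis
    unfolding eq using measurable_coordinate_Rn[OF P(2) assms(2)] by (subst (asm) integrable_distr_eq) auto
qed

text \<open>\<open>gaussian_Rn\<close> only asserts that each linear functional has some parameters.
  Comparing the first two moments of its law identifies them with the values computed from mean
  vector and covariance matrix.\<close>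

lemma gaussian_Rn_linear_law:
  assumes G: "gaussian_Rn n P" and D: "normal_law (distr P lborel (\<lambda>y. \<Sum>i<n. a i * y i)) m \<sigma>"
  shows "m = (\<Sum>i<n. a i * mean_vec P i)" "\<sigma>\<^sup>2 = (\<Sum>i<n. \<Sum>j<n. a i * a j * cov_mat P i j)"
    "(\<integral>y. iexp (\<Sum>i<n. a i * y i) \<partial>P) = iexp m * of_real (exp (- \<sigma>\<^sup>2 / 2))"
proof -
  have P: "is_prob_Rn n P" "prob_space P" "sets P = sets (Rn n)"
    using G by (auto simp: gaussian_Rn_def is_prob_Rn_def)
  have [measurable]: "(\<lambda>y. \<Sum>i<n. a i * y i) \<in> borel_measurable P"
    by (rule measurable_linear_Rn[OF P(3)])
  note sq = gaussian_Rn_square_integrable[OF G]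
  have "m = (\<integral>y. (\<Sum>i<n. a i * y i) \<partial>P)"
    using normal_law_moments(2)[OF D] by (simp add: integral_distr)
  also have "\<dots> = (\<Sum>i<n. a i * mean_vec P i)"
    using affine_square_moment(3)[OF _ P(2), of "{..<n}" a] sq measurable_coordinate_Rn[OF P(3)]
    by (simp add: mean_vec_def)
  finally show m: "m = (\<Sum>i<n. a i * mean_vec P i)" .
  show "\<sigma>\<^sup>2 = (\<Sum>i<n. \<Sum>j<n. a i * a j * cov_mat P i j)"
    using normal_law_moments(3)[OF D] quadratic_form_cov_mat_eq_variance(1)[OF P(1) sq, of a] unfolding m
    by (simp add: integral_distr)
  show "(\<integral>y. iexp (\<Sum>i<n. a i * y i) \<partial>P) = iexp m * of_real (exp (- \<sigma>\<^sup>2 / 2))"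
    using normal_law_moments(4)[OF D, of 1] by (simp add: integral_distr)
qed

lemma gaussian_Rn_char:
  assumes "gaussian_Rn n P"
  shows "(\<integral>y. iexp (\<Sum>i<n. a i * y i) \<partial>P) = iexp (\<Sum>i<n. a i * mean_vec P i)
    * of_real (exp (- (\<Sum>i<n. \<Sum>j<n. a i * a j * cov_mat P i j) / 2))"
proof -
  obtain m \<sigma> where "normal_law (distr P lborel (\<lambda>y. \<Sum>j<n. a j * y j)) m \<sigma>"
    using assms unfolding gaussian_Rn_def normal_law_def by blast
  from gaussian_Rn_linear_law[OF assms this] show ?thesis by simp
qed

text \<open>Polarisation: unit vectors give the diagonal entries, and the sum of two unit vectors
  then gives \<open>V i j + V j i\<close>.\<close>

lemma quadratic_form_eqD:
  fixes V W :: "nat \<Rightarrow> nat \<Rightarrow> real"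
  assumes eq: "\<And>a. (\<Sum>i<n. \<Sum>j<n. a i * a j * V i j) = (\<Sum>i<n. \<Sum>j<n. a i * a j * W i j)"
    and sym: "\<And>i j. i < n \<Longrightarrow> j < n \<Longrightarrow> V i j = V j i" "\<And>i j. i < n \<Longrightarrow> j < n \<Longrightarrow> W i j = W j i"
    and ij: "i < n" "j < n"
  shows "V i j = W i j"
proof -
  have diag: "(\<Sum>k<n. \<Sum>l<n. (if k = i then 1 else 0) * (if l = j then 1 else 0) * U k l) = U i j"
    if "i < n" "j < n" for i j and U :: "nat \<Rightarrow> nat \<Rightarrow> real"
  proof -
    have "(\<Sum>k<n. \<Sum>l<n. (if k = i then 1 else 0) * (if l = j then 1 else 0) * U k l) =
       (\<Sum>k<n. \<Sum>l<n. if k = i then (if l = j then U k l else 0) else 0)"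
      by (intro sum.cong refl) simp
    also have "\<dots> = (\<Sum>k<n. if k = i then (\<Sum>l<n. if l = j then U k l else 0) else 0)"
      by (intro sum.cong refl) simp
    also have "\<dots> = (\<Sum>l<n. if l = j then U i l else 0)" using that by (subst sum.delta) auto
    also have "\<dots> = U i j" using that by (subst sum.delta) auto
    finally show ?thesis .
  qed
  have two: "(\<Sum>k<n. \<Sum>l<n. ((if k = i then 1 else 0) + (if k = j then 1 else 0)) *
      ((if l = i then 1 else 0) + (if l = j then 1 else 0)) * U k l) = U i i + U i j + U j i + U j j"
    for U :: "nat \<Rightarrow> nat \<Rightarrow> real"
    unfolding distrib_right distrib_left sum.distrib using ij by (simp only: diag)
  have "V i i = W i i" "V j j = W j j"
    using eq[of "\<lambda>k. if k = i then 1 else 0"] eq[of "\<lambda>k. if k = j then 1 else 0"] ij unfolding diag by (simp_all add: diag)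
  moreover have "V i i + V i j + V j i + V j j = W i i + W i j + W j i + W j j"
    using eq[of "\<lambda>k. (if k = i then 1 else 0) + (if k = j then 1 else 0)"] unfolding two .
  ultimately show ?thesis using sym(1)[OF ij] sym(2)[OF ij] by simp
qed

lemma cov_mat_sym: "cov_mat P i j = cov_mat P j i"
  by (simp add: cov_mat_def mult.commute)

text \<open>Along the line \<open>t * a\<close> the given function is the characteristic function of
  a normal law, so Levy's theorem identifies the law of each linear functional; nonnegativity of the
  form supplies the standard deviation as a square root. Mean and covariance are then read off from
  these laws.\<close>

lemma gaussian_RnI_char:
  assumes P: "is_prob_Rn n P"
    and char: "\<And>a. (\<integral>y. iexp (\<Sum>i<n. a i * y i) \<partial>P) = iexp (\<Sum>i<n. a i * m i)
      * of_real (exp (- (\<Sum>i<n. \<Sum>j<n. a i * a j * V i j) / 2))"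
    and V: "\<And>a. 0 \<le> (\<Sum>i<n. \<Sum>j<n. a i * a j * V i j)"
    and sym: "\<And>i j. i < n \<Longrightarrow> j < n \<Longrightarrow> V i j = V j i"
  shows "gaussian_Rn n P" and "\<And>i. i < n \<Longrightarrow> mean_vec P i = m i"
    and "\<And>i j. i < n \<Longrightarrow> j < n \<Longrightarrow> cov_mat P i j = V i j"
proof -
  have P': "prob_space P" "sets P = sets (Rn n)" using P by (auto simp: is_prob_Rn_def)
  interpret prob_space P by fact
  have law: "normal_law (distr P lborel (\<lambda>y. \<Sum>i<n. a i * y i)) (\<Sum>i<n. a i * m i)
      (sqrt (\<Sum>i<n. \<Sum>j<n. a i * a j * V i j))" (is "normal_law ?D ?m ?s") for a
  proof -
    have [measurable]: "(\<lambda>y. \<Sum>i<n. a i * y i) \<in> borel_measurable P"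
      by (rule measurable_linear_Rn[OF P'(2)])
    define N where "N = (if ?s = 0 then return lborel ?m else density lborel (\<lambda>t. ennreal (normal_density ?m ?s t)))"
    have N: "normal_law N ?m ?s" using real_sqrt_ge_zero[OF V[of a]] by (auto simp: normal_law_def N_def)
    have D: "?D = distr P borel (\<lambda>y. \<Sum>i<n. a i * y i)" by (intro distr_cong) auto
    have "?D = N"
    proof (rule Levy_uniqueness)
      show "real_distribution ?D" unfolding D by (rule real_distribution_distr) simp
      show "real_distribution N" by (rule normal_law_moments(5)[OF N])
      show "char ?D = char N"
      proof
        fix t
        have "char ?D t = (\<integral>y. iexp (\<Sum>i<n. (t * a i) * y i) \<partial>P)"
          unfolding char_def by (subst integral_distr) (auto simp: sum_distrib_left mult.assoc)
        also have "\<dots> = iexp (\<Sum>i<n. (t * a i) * m i) *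
            of_real (exp (- (\<Sum>i<n. \<Sum>j<n. (t * a i) * (t * a j) * V i j) / 2))" by (rule char)
        also have "(\<Sum>i<n. (t * a i) * m i) = t * ?m" by (simp add: sum_distrib_left mult.assoc)
        also have "(\<Sum>i<n. \<Sum>j<n. (t * a i) * (t * a j) * V i j) = (t * ?s)\<^sup>2"
          using V[of a] by (simp add: power_mult_distrib sum_distrib_left power2_eq_square mult_ac)
        also have "iexp (t * ?m) * of_real (exp (- (t * ?s)\<^sup>2 / 2)) = char N t"
          unfolding char_def normal_law_moments(4)[OF N] ..
        finally show "char ?D t = char N t" .
      qed
    qed
    with N show ?thesis by simp
  qed
  show G: "gaussian_Rn n P"
    using law P unfolding gaussian_Rn_def normal_law_def by blast
  note LL = gaussian_Rn_linear_law[OF G law]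
  show "mean_vec P i = m i" if "i < n" for i
  proof -
    have "(\<Sum>j<n. (if j = i then 1 else 0) * f j) = f i" for f :: "nat \<Rightarrow> real"
    proof -
      have "(\<Sum>j<n. (if j = i then 1 else 0) * f j) = (\<Sum>j<n. if j = i then f j else 0)" by (intro sum.cong) auto
      then show ?thesis using that by simp
    qed
    then show ?thesis using LL(1)[of "\<lambda>j. if j = i then 1 else 0"] by simp
  qed
  show "cov_mat P i j = V i j" if "i < n" "j < n" for i j
    using that LL(2) V by (intro quadratic_form_eqD[where n=n and V="cov_mat P" and W=V]) (auto simp: cov_mat_sym sym)
qed

lemma gaussian_Rn_eqI:
  assumes "gaussian_Rn n P" "gaussian_Rn n Q"
    and "\<And>i. i < n \<Longrightarrow> mean_vec P i = mean_vec Q i" "\<And>i j. i < n \<Longrightarrow> j < n \<Longrightarrow> cov_mat P i j = cov_mat Q i j"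
  shows "P = Q"
proof (rule PiM_eqI_char[of "{..<n}"])
  show "(\<integral>y. iexp (\<Sum>i<n. a i * y i) \<partial>P) = (\<integral>y. iexp (\<Sum>i<n. a i * y i) \<partial>Q)" for a
    unfolding gaussian_Rn_char[OF assms(1)] gaussian_Rn_char[OF assms(2)] using assms(3,4) by simp
qed (use assms(1,2) in \<open>auto simp: gaussian_Rn_def is_prob_Rn_def Rn_def\<close>)

lemma nondegenerate_Rn_posdef_on: "nondegenerate_Rn n P \<Longrightarrow> posdef_on {..<n} (cov_mat P)"
  unfolding nondegenerate_Rn_def posdef_on_def by (auto simp: cov_mat_sym)

lemma gaussian_Rn_exists:
  fixes V :: "nat \<Rightarrow> nat \<Rightarrow> real"
  assumes V: "posdef_on {..<n} V"
  shows "\<exists>q. quadratic_log {..<n} q \<and> gaussian_Rn n (density (Rn n) (\<lambda>y. ennreal (exp (q y)))) \<and>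
     (\<forall>i<n. mean_vec (density (Rn n) (\<lambda>y. ennreal (exp (q y)))) i = m i) \<and>
     (\<forall>i<n. \<forall>j<n. cov_mat (density (Rn n) (\<lambda>y. ennreal (exp (q y)))) i j = V i j)"
proof -
  obtain q where q: "quadratic_log {..<n} q"
    and p: "prob_space (density (Rn n) (\<lambda>y. ennreal (exp (q y))))"
    and c: "\<And>a. (\<integral>y. exp (q y) *\<^sub>R iexp (\<Sum>j<n. a j * y j) \<partial>Rn n) =
       iexp (\<Sum>j<n. a j * m j) * of_real (exp (- (\<Sum>i<n. \<Sum>j<n. a i * a j * V i j) / 2))"
    using gaussian_density_exists[OF finite_lessThan V, of m] unfolding Rn_def by blast
  have [measurable]: "q \<in> borel_measurable (Rn n)" by (rule quadratic_log_measurable[OF q]) (simp add: Rn_def)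
  let ?P = "density (Rn n) (\<lambda>y. ennreal (exp (q y)))"
  have P: "is_prob_Rn n ?P" using p by (simp add: is_prob_Rn_def)
  have 1: "(\<integral>y. iexp (\<Sum>j<n. a j * y j) \<partial>?P) =
       iexp (\<Sum>j<n. a j * m j) * of_real (exp (- (\<Sum>i<n. \<Sum>j<n. a i * a j * V i j) / 2))" for a
  proof -
    have [measurable]: "(\<lambda>y. \<Sum>i<n. a i * y i) \<in> borel_measurable (Rn n)" by (rule measurable_linear_Rn) simp
    have "(\<lambda>y. iexp (\<Sum>i<n. a i * y i)) \<in> borel_measurable (Rn n)" by measurable
    then show ?thesis unfolding c[symmetric] by (subst integral_density) auto
  qed
  have 2: "V i j = V j i" if "i < n" "j < n" for i j using V that unfolding posdef_on_def by simp
  show ?thesis using q gaussian_RnI_char[OF P 1 posdef_on_nonneg[OF V] 2] by blast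
qed

section \<open>Kullback-Leibler divergence from Gaussian laws\<close>

lemma RN_deriv_AE_pos_finite:
  assumes "prob_space P" "prob_space Q" "sets P = sets Q" "absolutely_continuous Q P"
  shows "AE x in P. 0 < RN_deriv Q P x \<and> RN_deriv Q P x < \<infinity>"
proof -
  interpret P: prob_space P by fact
  interpret Q: prob_space Q by fact
  have D: "density Q (RN_deriv Q P) = P" using assms by (intro Q.density_RN_deriv) auto
  have "AE x in Q. RN_deriv Q P x \<noteq> \<infinity>"
    using assms P.sigma_finite_measure_axioms by (intro Q.RN_deriv_finite) auto
  then have "AE x in Q. 0 < RN_deriv Q P x \<longrightarrow> 0 < RN_deriv Q P x \<and> RN_deriv Q P x < \<infinity>"
    by (auto simp: less_top)
  then show ?thesis by (subst D[symmetric]) (simp add: AE_density)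
qed

text \<open>Integrate \<open>ln (g / f) \<le> g / f - 1\<close>, where \<open>f\<close> is the density of \<open>P\<close> with respect to \<open>Q\<close>.\<close>
lemma gibbs_inequality:
  fixes g :: "'a \<Rightarrow> real"
  assumes "prob_space P" "prob_space Q" and sets: "sets P = sets Q" and ac: "absolutely_continuous Q P"
    and int: "integrable P (\<lambda>x. ln (enn2real (RN_deriv Q P x)))"
    and [measurable]: "g \<in> borel_measurable Q"
    and g0: "\<And>x. 0 \<le> g x" and g1: "(\<integral>\<^sup>+x. ennreal (g x) \<partial>Q) \<le> 1"
    and gpos: "AE x in P. 0 < g x" and neg: "integrable P (\<lambda>x. min 0 (ln (g x)))"
  shows "integrable P (\<lambda>x. ln (g x))"
    and "(\<integral>x. ln (g x) \<partial>P) \<le> (\<integral>x. ln (enn2real (RN_deriv Q P x)) \<partial>P)"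
proof -
  interpret P: prob_space P by fact
  interpret Q: prob_space Q by fact
  note [measurable_cong] = sets
  define f where "f x = enn2real (RN_deriv Q P x)" for x
  have [measurable]: "f \<in> borel_measurable Q" unfolding f_def by measurable
  have D: "density Q (RN_deriv Q P) = P" using sets ac by (intro Q.density_RN_deriv) auto
  \<comment> \<open>\<open>enn2real\<close> sends \<infinity> to 0 and the value of
    \<open>ln\<close> at 0 is a convention, so \<open>ln (f x)\<close> has its intended meaning only
    where the derivative is positive and finite.\<close>
  have fpos: "AE x in P. 0 < f x"
    using RN_deriv_AE_pos_finite[OF assms(1-4)] by eventually_elim (auto simp: f_def enn2real_positive_iff)
  \<comment> \<open>Where \<open>f x = 0\<close> the quotient is 0 by convention and the mass of
    \<open>g\<close> is lost, hence only an inequality.\<close>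
  have le: "(\<integral>\<^sup>+x. ennreal (g x / f x) \<partial>P) \<le> 1"
  proof -
    have "(\<integral>\<^sup>+x. ennreal (g x / f x) \<partial>P) = (\<integral>\<^sup>+x. ennreal (g x / f x) \<partial>density Q (RN_deriv Q P))"
      by (simp only: D)
    also have "\<dots> = (\<integral>\<^sup>+x. RN_deriv Q P x * ennreal (g x / f x) \<partial>Q)"
      by (rule nn_integral_density) auto
    also have "\<dots> \<le> (\<integral>\<^sup>+x. ennreal (g x) \<partial>Q)"
    proof (intro nn_integral_mono)
      fix x
      show "RN_deriv Q P x * ennreal (g x / f x) \<le> ennreal (g x)"
      proof (cases "0 < f x")
        case True
        then have "RN_deriv Q P x = ennreal (f x)"
          by (auto simp: f_def enn2real_positive_iff)
        then show ?thesis using True g0[of x] by (simp add: ennreal_mult'[symmetric])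
      next
        case False
        then have "f x = 0" by (simp add: f_def order.antisym)
        then show ?thesis by simp
      qed
    qed
    finally show ?thesis using g1 by simp
  qed
  have gf0: "0 \<le> g x / f x" for x using g0 by (simp add: f_def)
  have gf: "integrable P (\<lambda>x. g x / f x)"
    using le gf0 by (intro integrableI_nonneg) (auto simp: le_less_trans[OF le])
  have gf1: "(\<integral>x. g x / f x \<partial>P) \<le> 1"
    using le gf0 nn_integral_eq_integral[OF gf] by (simp add: ennreal_le_1)
  \<comment> \<open>\<open>U\<close> is an integrable majorant of \<open>ln (g x)\<close> and
    controls its positive part; the negative part is controlled by \<open>neg\<close>.\<close>
  define U where "U x = ln (f x) + g x / f x - 1" for x
  have U: "integrable P U" unfolding U_def using int gf by (auto simp: f_def)
  have up: "AE x in P. ln (g x) \<le> U x" using fpos gpos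
  proof eventually_elim
    case (elim x)
    then have "ln (g x / f x) \<le> g x / f x - 1" by (intro ln_le_minus_one) auto
    then show ?case using elim by (simp add: U_def ln_div)
  qed
  show i: "integrable P (\<lambda>x. ln (g x))"
  proof (rule Bochner_Integration.integrable_bound)
    show "integrable P (\<lambda>x. \<bar>min 0 (ln (g x))\<bar> + \<bar>U x\<bar>)" using neg U by auto
    show "AE x in P. norm (ln (g x)) \<le> norm (\<bar>min 0 (ln (g x))\<bar> + \<bar>U x\<bar>)"
      using up by eventually_elim auto
  qed measurable
  have "(\<integral>x. ln (g x) \<partial>P) \<le> (\<integral>x. U x \<partial>P)" using i U up by (rule integral_mono_AE)
  also have "\<dots> = (\<integral>x. ln (f x) \<partial>P) + (\<integral>x. g x / f x \<partial>P) - 1"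
    unfolding U_def using int gf by (simp add: f_def P.prob_space)
  also have "\<dots> \<le> (\<integral>x. ln (f x) \<partial>P)" using gf1 by simp
  finally show "(\<integral>x. ln (g x) \<partial>P) \<le> (\<integral>x. ln (enn2real (RN_deriv Q P x)) \<partial>P)" by (simp add: f_def)
qed

lemma KL_nonneg:
  assumes "prob_space P" "prob_space Q"
  shows "0 \<le> KL P Q"
proof -
  interpret Q: prob_space Q by fact
  show ?thesis
    using gibbs_inequality(2)[OF assms, of "\<lambda>_. 1"] by (auto simp: KL_def Q.emeasure_space_1)
qed

text \<open>Seen from \<open>Q\<close>, the integrand picks up the density \<open>u\<close> as a
  factor, and \<open>u * (- ln u)\<close> is at most 1 for \<open>u\<close> between 0 and 1 because
  \<open>ln (1 / u) \<le> 1 / u - 1\<close>. This provides the hypothesis \<open>neg\<close> of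
  \<open>gibbs_inequality\<close> when \<open>g\<close> comes from a Radon-Nikodym
  derivative.\<close>

lemma integrable_neg_part_ln_RN_deriv:
  assumes "prob_space P" "prob_space Q" and sets: "sets P = sets Q" and ac: "absolutely_continuous Q P"
  shows "integrable P (\<lambda>x. min 0 (ln (enn2real (RN_deriv Q P x))))"
proof (rule integrableI_bounded)
  interpret P: prob_space P by fact
  interpret Q: prob_space Q by fact
  note [measurable_cong] = sets
  show "(\<lambda>x. min 0 (ln (enn2real (RN_deriv Q P x)))) \<in> borel_measurable P" by measurable
  have D: "density Q (RN_deriv Q P) = P" using sets ac by (intro Q.density_RN_deriv) auto
  have bound: "r * ennreal (norm (min 0 (ln (enn2real r)))) \<le> 1" for r :: ennreal
  proof (cases r)
    case (real u)
    show ?thesis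
    proof (cases "0 < u \<and> u < 1")
      case True
      then have "ln (1 / u) \<le> 1 / u - 1" by (intro ln_le_minus_one) auto
      then have "u * (- ln u) \<le> u * (1 / u - 1)" using True by (intro mult_left_mono) (auto simp: ln_div)
      also have "\<dots> \<le> 1" using True by (simp add: field_simps)
      finally show ?thesis using True real by (simp add: ennreal_mult'[symmetric] ennreal_le_1)
    next
      case False
      then have "u = 0 \<or> 1 \<le> u" using real by auto
      then show ?thesis using real by auto
    qed
  qed simp
  have "(\<integral>\<^sup>+x. ennreal (norm (min 0 (ln (enn2real (RN_deriv Q P x))))) \<partial>P) =
      (\<integral>\<^sup>+x. ennreal (norm (min 0 (ln (enn2real (RN_deriv Q P x))))) \<partial>density Q (RN_deriv Q P))"
    by (simp only: D)
  also have "\<dots> = (\<integral>\<^sup>+x. RN_deriv Q P x * ennreal (norm (min 0 (ln (enn2real (RN_deriv Q P x))))) \<partial>Q)"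
    by (rule nn_integral_density) auto
  also have "\<dots> \<le> (\<integral>\<^sup>+x. 1 \<partial>Q)" by (intro nn_integral_mono bound)
  also have "\<dots> < \<infinity>" by (simp add: Q.emeasure_space_1)
  finally show "(\<integral>\<^sup>+x. ennreal (norm (min 0 (ln (enn2real (RN_deriv Q P x))))) \<partial>P) < \<infinity>" .
qed

text \<open>The density of the image laws, pulled back along \<open>T\<close>, is a function
  \<open>g\<close> of mass at most 1 under \<open>Q\<close>, and the integral of
  \<open>ln (g x)\<close> under \<open>P\<close> is the divergence of the images. The Gibbs
  inequality bounds it by \<open>KL P Q\<close>; its integrability part shows that the image
  divergence is finite whenever \<open>KL P Q\<close> is.\<close>

theorem KL_distr_le:
  assumes "prob_space P" "prob_space Q" and T: "T \<in> measurable Q K"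
  shows "KL (distr P K T) (distr Q K T) \<le> KL P Q"
proof (cases "KL P Q = \<infinity>")
  case False
  then have sets: "sets P = sets Q" and ac: "absolutely_continuous Q P"
    and int: "integrable P (\<lambda>x. ln (enn2real (RN_deriv Q P x)))"
    and KL: "KL P Q = ereal (\<integral>x. ln (enn2real (RN_deriv Q P x)) \<partial>P)"
    by (auto simp: KL_def split: if_splits)
  interpret P: prob_space P by fact
  interpret Q: prob_space Q by fact
  note [measurable_cong] = sets and [measurable] = T
  let ?P = "distr P K T" and ?Q = "distr Q K T"
  have [measurable]: "T \<in> measurable P K" by simp
  interpret P': prob_space ?P by (rule P.prob_space_distr) simp
  interpret Q': prob_space ?Q by (rule Q.prob_space_distr) simp
  have sets': "sets ?P = sets ?Q" by simp
  have ac': "absolutely_continuous ?Q ?P"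
    unfolding absolutely_continuous_def
  proof
    fix A assume "A \<in> null_sets ?Q"
    then have A: "A \<in> sets K" "emeasure Q (T -` A \<inter> space Q) = 0"
      by (auto simp: null_sets_def emeasure_distr)
    then have "T -` A \<inter> space Q \<in> null_sets Q" using T by (intro null_setsI) auto
    then have "T -` A \<inter> space Q \<in> null_sets P"
      using ac unfolding absolutely_continuous_def by blast
    then show "A \<in> null_sets ?P" using A(1) sets_eq_imp_space_eq[OF sets]
      by (auto simp: null_sets_def emeasure_distr)
  qed
  define r where "r = RN_deriv ?Q ?P"
  have [measurable]: "r \<in> borel_measurable K"
    using borel_measurable_RN_deriv[of ?Q ?P] unfolding r_def[symmetric] by simp
  have D: "density ?Q r = ?P" unfolding r_def using ac' by (intro Q'.density_RN_deriv) auto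
  define g where "g x = enn2real (r (T x))" for x
  have [measurable]: "g \<in> borel_measurable Q" unfolding g_def by measurable
  have g1: "(\<integral>\<^sup>+x. ennreal (g x) \<partial>Q) \<le> 1"
  proof -
    have "(\<integral>\<^sup>+x. ennreal (g x) \<partial>Q) \<le> (\<integral>\<^sup>+x. r (T x) \<partial>Q)"
      unfolding g_def by (intro nn_integral_mono) (auto simp: ennreal_enn2real_if)
    also have "\<dots> = (\<integral>\<^sup>+z. r z \<partial>?Q)" by (subst nn_integral_distr) auto
    also have "\<dots> = emeasure (density ?Q r) (space (density ?Q r))"
      by (subst emeasure_density) (auto intro!: nn_integral_cong)
    also have "\<dots> = 1" unfolding D by (rule P'.emeasure_space_1)
    finally show ?thesis .
  qed
  have gpos: "AE x in P. 0 < g x"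
  proof -
    have "AE z in ?P. 0 < enn2real (r z)"
      using RN_deriv_AE_pos_finite[OF P'.prob_space_axioms Q'.prob_space_axioms sets' ac']
      unfolding r_def[symmetric] by eventually_elim (auto simp: enn2real_positive_iff)
    then show ?thesis unfolding g_def by (subst (asm) AE_distr_iff) auto
  qed
  have neg: "integrable P (\<lambda>x. min 0 (ln (g x)))"
    using integrable_neg_part_ln_RN_deriv[OF P'.prob_space_axioms Q'.prob_space_axioms sets' ac']
    unfolding r_def[symmetric] g_def by (subst (asm) integrable_distr_eq) auto
  have g0: "0 \<le> g x" for x by (simp add: g_def)
  note G = gibbs_inequality[OF assms(1,2) sets ac int _ g0 g1 gpos neg, simplified]
  have "integrable ?P (\<lambda>z. ln (enn2real (r z)))"
    using G(1) unfolding g_def by (subst integrable_distr_eq) auto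
  moreover have "(\<integral>z. ln (enn2real (r z)) \<partial>?P) = (\<integral>x. ln (g x) \<partial>P)"
    unfolding g_def by (subst integral_distr) auto
  ultimately show ?thesis
    using G(2) ac' unfolding KL unfolding KL_def r_def[symmetric] by simp
qed simp

text \<open>A density \<open>exp (q x)\<close> never vanishes, so \<open>P\<close> is absolutely
  continuous with respect to \<open>Q\<close> with derivative \<open>p x * exp (- q x)\<close>. As
  \<open>q\<close> is integrable under \<open>P\<close>, finiteness of the divergence depends on
  \<open>p\<close> alone and is the same for all such \<open>Q\<close>.\<close>

lemma KL_exp_density:
  fixes q :: "'a \<Rightarrow> real"
  assumes [measurable]: "p \<in> borel_measurable L" "q \<in> borel_measurable L"
    and P: "P = density L p" "prob_space P" and Q: "Q = density L (\<lambda>x. ennreal (exp (q x)))" "prob_space Q"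
    and q: "integrable P q"
  shows "KL P Q = (if integrable P (\<lambda>x. ln (enn2real (p x)))
    then ereal ((\<integral>x. ln (enn2real (p x)) \<partial>P) - (\<integral>x. q x \<partial>P)) else \<infinity>)"
proof -
  interpret P: prob_space P by fact
  interpret Q: prob_space Q by fact
  have sets: "sets P = sets Q" and [measurable_cong]: "sets P = sets L" "sets Q = sets L" using P Q by auto
  define r where "r x = p x * ennreal (exp (- q x))" for x
  have [measurable]: "r \<in> borel_measurable L" unfolding r_def by measurable
  have D: "density Q r = P"
  proof -
    have "ennreal (exp (q x)) * r x = p x" for x
    proof -
      have "ennreal (exp (q x)) * r x = p x * ennreal (exp (q x) * exp (- q x))"
        unfolding r_def by (subst ennreal_mult) (auto simp: mult_ac)
      then show ?thesis by (simp add: exp_add[symmetric])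
    qed
    then show ?thesis unfolding P(1) Q(1) by (subst density_density_eq) auto
  qed
  have ac: "absolutely_continuous Q P" unfolding D[symmetric] by (rule absolutely_continuousI_density) simp
  have "AE x in Q. r x = RN_deriv Q P x" using D by (intro Q.RN_deriv_unique) auto
  then have "AE x in P. r x = RN_deriv Q P x" by (rule absolutely_continuous_AE[OF sets ac])
  then have eq: "AE x in P. ln (enn2real (RN_deriv Q P x)) = ln (enn2real (p x)) - q x"
    using RN_deriv_AE_pos_finite[OF P(2) Q(2) sets ac]
  proof eventually_elim
    case (elim x)
    then have r: "0 < r x" "r x < \<infinity>" by auto
    have "0 < enn2real (p x)"
    proof (cases "p x")
      case (real u)
      with r show ?thesis by (cases "u = 0") (auto simp: r_def)
    next
      case top
      with r show ?thesis by (simp add: r_def ennreal_top_mult)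
    qed
    then have "ln (enn2real (p x) * exp (- q x)) = ln (enn2real (p x)) - q x" by (simp add: ln_mult)
    then show ?case using elim(1) by (simp add: r_def enn2real_mult flip: elim(1))
  qed
  have [measurable]: "RN_deriv Q P \<in> borel_measurable P" by simp
  have i: "integrable P (\<lambda>x. ln (enn2real (RN_deriv Q P x))) \<longleftrightarrow> integrable P (\<lambda>x. ln (enn2real (p x)))"
  proof -
    have "integrable P (\<lambda>x. ln (enn2real (RN_deriv Q P x))) \<longleftrightarrow> integrable P (\<lambda>x. ln (enn2real (p x)) - q x)"
      using eq by (intro integrable_cong_AE) auto
    also have "\<dots> \<longleftrightarrow> integrable P (\<lambda>x. ln (enn2real (p x)))"
      using q Bochner_Integration.integrable_add[of P "\<lambda>x. ln (enn2real (p x)) - q x" q] by auto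
    finally show ?thesis .
  qed
  moreover have "(\<integral>x. ln (enn2real (RN_deriv Q P x)) \<partial>P) = (\<integral>x. ln (enn2real (p x)) \<partial>P) - (\<integral>x. q x \<partial>P)"
    if "integrable P (\<lambda>x. ln (enn2real (p x)))"
  proof -
    have "(\<integral>x. ln (enn2real (RN_deriv Q P x)) \<partial>P) = (\<integral>x. ln (enn2real (p x)) - q x \<partial>P)"
      using eq by (intro integral_cong_AE) auto
    then show ?thesis using that q by simp
  qed
  ultimately show ?thesis using sets ac by (auto simp: KL_def)
qed

section \<open>Gaussian laws as projections for the divergence\<close>

lemma quadratic_log_integral:
  assumes q: "quadratic_log {..<n} q" and P: "is_prob_Rn n P" "\<And>i. i < n \<Longrightarrow> integrable P (\<lambda>y. (y i)\<^sup>2)"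
    and G: "is_prob_Rn n G" "\<And>i. i < n \<Longrightarrow> integrable G (\<lambda>y. (y i)\<^sup>2)"
    and mom: "\<And>i. i < n \<Longrightarrow> mean_vec P i = mean_vec G i"
      "\<And>i j. i < n \<Longrightarrow> j < n \<Longrightarrow> cov_mat P i j = cov_mat G i j"
  shows "integrable P q" and "(\<integral>y. q y \<partial>P) = (\<integral>y. q y \<partial>G)"
proof -
  obtain C \<beta> A where "\<forall>y. q y = C - (\<Sum>k<n. (\<beta> k + (\<Sum>j<n. A k j * y j))\<^sup>2)"
    using q unfolding quadratic_log_def by blast
  then have q': "q = (\<lambda>y. C - (\<Sum>k<n. (\<beta> k + (\<Sum>j<n. A k j * y j))\<^sup>2))" by blast
  have *: "integrable R q \<and> (\<integral>y. q y \<partial>R) = C - (\<Sum>k<n. (\<Sum>i<n. \<Sum>j<n. A k i * A k j * cov_mat R i j)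
      + (\<beta> k + (\<Sum>j<n. A k j * mean_vec R j))\<^sup>2)"
    if R: "is_prob_Rn n R" "\<And>i. i < n \<Longrightarrow> integrable R (\<lambda>y. (y i)\<^sup>2)" for R
  proof -
    have R': "prob_space R" "sets R = sets (Rn n)" using R by (auto simp: is_prob_Rn_def)
    interpret prob_space R by fact
    have m: "\<And>j. j \<in> {..<n} \<Longrightarrow> (\<lambda>y. y j) \<in> borel_measurable R"
      using measurable_coordinate_Rn[OF R'(2)] by simp
    have s: "\<And>j. j \<in> {..<n} \<Longrightarrow> integrable R (\<lambda>y. (y j)\<^sup>2)" using R(2) by simp
    note M = affine_square_moment(1,2)[OF finite_lessThan R'(1) m s]
    have "(\<integral>y. q y \<partial>R) = C - (\<Sum>k<n. \<integral>y. (\<beta> k + (\<Sum>j<n. A k j * y j))\<^sup>2 \<partial>R)"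
      unfolding q' using M(1)
      by (subst Bochner_Integration.integral_diff) (auto simp: prob_space intro!: Bochner_Integration.integrable_sum)
    moreover have "integrable R q" unfolding q' using M(1) by auto
    moreover have "(\<Sum>k<n. \<integral>y. (\<beta> k + (\<Sum>j<n. A k j * y j))\<^sup>2 \<partial>R) =
        (\<Sum>k<n. (\<Sum>i<n. \<Sum>j<n. A k i * A k j * cov_mat R i j) + (\<beta> k + (\<Sum>j<n. A k j * mean_vec R j))\<^sup>2)"
      unfolding cov_mat_def mean_vec_def by (intro sum.cong refl M(2))
    ultimately show ?thesis by simp
  qed
  show "integrable P q" using *[OF P] by simp
  show "(\<integral>y. q y \<partial>P) = (\<integral>y. q y \<partial>G)" using *[OF P] *[OF G] mom by simp
qed

text \<open>Positive definiteness allows the construction of a Gaussian law with quadratic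
  log-density and the moments of \<open>Q\<close>; since moments determine Gaussian laws, it is
  \<open>Q\<close>.\<close>

lemma gaussian_Rn_density:
  assumes "gaussian_Rn n Q" "posdef_on {..<n} (cov_mat Q)"
  shows "\<exists>q. quadratic_log {..<n} q \<and> Q = density (Rn n) (\<lambda>y. ennreal (exp (q y)))"
proof -
  obtain q where q: "quadratic_log {..<n} q" "gaussian_Rn n (density (Rn n) (\<lambda>y. ennreal (exp (q y))))"
    "\<forall>i<n. mean_vec (density (Rn n) (\<lambda>y. ennreal (exp (q y)))) i = mean_vec Q i"
    "\<forall>i<n. \<forall>j<n. cov_mat (density (Rn n) (\<lambda>y. ennreal (exp (q y)))) i j = cov_mat Q i j"
    using gaussian_Rn_exists[OF assms(2), of "mean_vec Q"] by blast
  then have "Q = density (Rn n) (\<lambda>y. ennreal (exp (q y)))"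
    by (intro gaussian_Rn_eqI[OF assms(1)]) auto
  then show ?thesis using q(1) by blast
qed

text \<open>The log-densities of \<open>G\<close> and \<open>Q\<close> are quadratic, so their expectations under \<open>P\<close> and under \<open>G\<close> agree.\<close>
lemma KL_gaussian_pythagoras:
  assumes P: "is_prob_Rn n P" "has_lebesgue_density n P" "nondegenerate_Rn n P"
    and G: "gaussian_Rn n G" "\<And>i. i < n \<Longrightarrow> mean_vec P i = mean_vec G i"
      "\<And>i j. i < n \<Longrightarrow> j < n \<Longrightarrow> cov_mat P i j = cov_mat G i j"
    and Q: "gaussian_Rn n Q" "posdef_on {..<n} (cov_mat Q)"
  shows "KL P Q = KL P G + KL G Q" and "KL G Q \<noteq> \<infinity>"
proof -
  have pdG: "posdef_on {..<n} (cov_mat G)"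
    using nondegenerate_Rn_posdef_on[OF P(3)] G(3) unfolding posdef_on_def by simp
  obtain g where g: "quadratic_log {..<n} g" and Gd: "G = density (Rn n) (\<lambda>y. ennreal (exp (g y)))"
    using gaussian_Rn_density[OF G(1) pdG] by blast
  obtain q where q: "quadratic_log {..<n} q" and Qd: "Q = density (Rn n) (\<lambda>y. ennreal (exp (q y)))"
    using gaussian_Rn_density[OF Q] by blast
  obtain p where p[measurable]: "p \<in> borel_measurable (Rn n)" and Pd: "P = density (Rn n) p"
    using P(2) by (auto simp: has_lebesgue_density_def)
  have [measurable]: "g \<in> borel_measurable (Rn n)" "q \<in> borel_measurable (Rn n)"
    using quadratic_log_measurable[OF g, of "Rn n"] quadratic_log_measurable[OF q, of "Rn n"] by (auto simp: Rn_def)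
  have prob: "prob_space P" "prob_space G" "prob_space Q" "is_prob_Rn n G"
    using P(1) G(1) Q(1) by (auto simp: gaussian_Rn_def is_prob_Rn_def)
  have sqP: "integrable P (\<lambda>y. (y i)\<^sup>2)" if "i < n" for i using P(3) that by (auto simp: nondegenerate_Rn_def)
  note sqG = gaussian_Rn_square_integrable[OF G(1)]
  have int: "integrable P f" "integrable G f" "(\<integral>y. f y \<partial>P) = (\<integral>y. f y \<partial>G)" if "quadratic_log {..<n} f" for f
    using quadratic_log_integral[OF that P(1) sqP prob(4) sqG G(2,3)]
      quadratic_log_integral(1)[OF that prob(4) sqG P(1) sqP] G(2,3) by auto
  have PQ: "KL P Q = (if integrable P (\<lambda>x. ln (enn2real (p x)))
      then ereal ((\<integral>x. ln (enn2real (p x)) \<partial>P) - (\<integral>x. q x \<partial>P)) else \<infinity>)"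
    by (rule KL_exp_density[OF _ _ Pd prob(1) Qd prob(3) int(1)[OF q]]) auto
  have PG: "KL P G = (if integrable P (\<lambda>x. ln (enn2real (p x)))
      then ereal ((\<integral>x. ln (enn2real (p x)) \<partial>P) - (\<integral>x. g x \<partial>P)) else \<infinity>)"
    by (rule KL_exp_density[OF _ _ Pd prob(1) Gd prob(2) int(1)[OF g]]) auto
  have "KL G Q = (if integrable G (\<lambda>x. ln (enn2real (ennreal (exp (g x)))))
      then ereal ((\<integral>x. ln (enn2real (ennreal (exp (g x)))) \<partial>G) - (\<integral>x. q x \<partial>G)) else \<infinity>)"
    by (rule KL_exp_density[OF _ _ Gd prob(2) Qd prob(3) int(2)[OF q]]) auto
  then have GQ: "KL G Q = ereal ((\<integral>x. g x \<partial>G) - (\<integral>x. q x \<partial>G))" using int(2)[OF g] by simp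
  \<comment> \<open>If the logarithm of \<open>p\<close> is not integrable, both divergences from
    \<open>P\<close> are \<infinity> while \<open>KL G Q\<close> is real, so the identity holds in
    that case too.\<close>
  show "KL P Q = KL P G + KL G Q" unfolding PQ PG GQ using int(3)[OF g] int(3)[OF q] by simp
  show "KL G Q \<noteq> \<infinity>" by (simp add: GQ)
qed

text \<open>A linear functional that is almost surely constant under \<open>Q\<close> is so under \<open>P \<lless> Q\<close> as well.\<close>
lemma posdef_on_cov_mat_absolutely_continuous:
  assumes P: "is_prob_Rn n P" "nondegenerate_Rn n P" and Q: "gaussian_Rn n Q" and ac: "absolutely_continuous Q P"
  shows "posdef_on {..<n} (cov_mat Q)"
proof (rule ccontr)
  assume "\<not> posdef_on {..<n} (cov_mat Q)"
  then obtain a k where k: "k < n" "a k \<noteq> 0" and le: "(\<Sum>i<n. \<Sum>j<n. a i * a j * cov_mat Q i j) \<le> 0"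
    by (auto simp: posdef_on_def cov_mat_sym not_less)
  have Q': "is_prob_Rn n Q" using Q by (auto simp: gaussian_Rn_def)
  have sets: "sets P = sets (Rn n)" "sets Q = sets (Rn n)" using P(1) Q' by (auto simp: is_prob_Rn_def)
  define c where "c = (\<Sum>i<n. a i * mean_vec Q i)"
  note V = quadratic_form_cov_mat_eq_variance[OF Q' gaussian_Rn_square_integrable[OF Q], of a, folded c_def]
  have "(\<integral>y. ((\<Sum>i<n. a i * y i) - c)\<^sup>2 \<partial>Q) = 0"
    using le V(1) by (intro antisym) auto
  then have "AE y in Q. (\<Sum>i<n. a i * y i) = c"
    using V(2) by (subst (asm) integral_nonneg_eq_0_iff_AE) auto
  then have AE: "AE y in P. (\<Sum>i<n. a i * y i) = c"
    using sets by (intro absolutely_continuous_AE[OF _ ac]) auto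
  have sq: "\<And>i. i < n \<Longrightarrow> integrable P (\<lambda>y. (y i)\<^sup>2)" using P(2) by (auto simp: nondegenerate_Rn_def)
  have prob: "prob_space P" using P(1) by (simp add: is_prob_Rn_def)
  have meas[measurable]: "(\<lambda>y. \<Sum>i<n. a i * y i) \<in> borel_measurable P"
    by (rule measurable_linear_Rn[OF sets(1)])
  \<comment> \<open>The constant \<open>c\<close>, introduced as the mean of the functional under
    \<open>Q\<close>, is also its mean under \<open>P\<close>. This turns the second moment around
    \<open>c\<close> into the covariance form of \<open>P\<close>.\<close>
  have "(\<Sum>i<n. a i * mean_vec P i) = (\<integral>y. (\<Sum>i<n. a i * y i) \<partial>P)"
    using affine_square_moment(3)[OF _ prob, of "{..<n}" a] sq measurable_coordinate_Rn[OF sets(1)]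
    by (simp add: mean_vec_def)
  also have "\<dots> = (\<integral>y. c \<partial>P)" using AE by (intro integral_cong_AE) auto
  also have "\<dots> = c" using prob by (simp add: prob_space.prob_space)
  finally have "(\<Sum>i<n. \<Sum>j<n. a i * a j * cov_mat P i j) = (\<integral>y. ((\<Sum>i<n. a i * y i) - c)\<^sup>2 \<partial>P)"
    using quadratic_form_cov_mat_eq_variance(1)[OF P(1) sq, of a] by simp
  also have "\<dots> = (\<integral>y. 0 \<partial>P)" using AE by (intro integral_cong_AE) auto
  finally show False using P(2) k unfolding nondegenerate_Rn_def by fastforce
qed

lemma KL_gaussian_projection_le:
  assumes P: "is_prob_Rn n P" "has_lebesgue_density n P" "nondegenerate_Rn n P"
    and G: "gaussian_Rn n G" "\<And>i. i < n \<Longrightarrow> mean_vec P i = mean_vec G i"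
      "\<And>i j. i < n \<Longrightarrow> j < n \<Longrightarrow> cov_mat P i j = cov_mat G i j"
    and Q: "gaussian_Rn n Q"
  shows "KL P G \<le> KL P Q"
proof (cases "KL P Q = \<infinity>")
  case False
  then have "absolutely_continuous Q P" by (auto simp: KL_def split: if_splits)
  then have "posdef_on {..<n} (cov_mat Q)" by (rule posdef_on_cov_mat_absolutely_continuous[OF P(1,3) Q])
  then have "KL P Q = KL P G + KL G Q" by (intro KL_gaussian_pythagoras(1)[OF P G Q])
  moreover have "0 \<le> KL G Q" using G(1) Q by (intro KL_nonneg) (auto simp: gaussian_Rn_def is_prob_Rn_def)
  ultimately show ?thesis by (metis add.right_neutral add_left_mono)
qed simp

lemma gauss_div_Rn_eq_KL:
  assumes P: "is_prob_Rn n P" "has_lebesgue_density n P" "nondegenerate_Rn n P"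
    and G: "gaussian_Rn n G" "\<And>i. i < n \<Longrightarrow> mean_vec P i = mean_vec G i"
      "\<And>i j. i < n \<Longrightarrow> j < n \<Longrightarrow> cov_mat P i j = cov_mat G i j"
    and Q: "gaussian_Rn n Q" "posdef_on {..<n} (cov_mat Q)"
    and fin: "KL P G \<noteq> \<infinity>"
  shows "gauss_div_Rn n P Q = KL G Q"
proof -
  have "(INF \<xi>\<in>{\<xi>. gaussian_Rn n \<xi>}. KL P \<xi>) = KL P G"
    using KL_gaussian_projection_le[OF P G] G(1) by (intro antisym INF_lower INF_greatest) auto
  moreover have "KL P G \<noteq> - \<infinity>" by (simp add: KL_def)
  ultimately show ?thesis
    using fin KL_gaussian_pythagoras[OF P G Q] unfolding gauss_div_Rn_def Let_def
    by (cases "KL P G"; cases "KL G Q") auto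
qed

section \<open>Processes\<close>

lemma sets_path_space: "sets path_space = sets (PiM UNIV (\<lambda>_. borel))"
  unfolding path_space_def by (intro sets_PiM_cong) auto

lemma measurable_process_coordinate:
  "is_process \<mu> \<Longrightarrow> (\<lambda>f. f t) \<in> borel_measurable \<mu>"
  unfolding is_process_def path_space_def by (simp cong: measurable_cong_sets)

lemma measurable_fdd_map:
  assumes "is_process \<mu>"
  shows "(\<lambda>f. \<lambda>i\<in>{..<length xs}. f (xs ! i)) \<in> measurable \<mu> (Rn (length xs))"
  unfolding Rn_def using measurable_process_coordinate[OF assms] by (intro measurable_restrict) simp

lemma is_prob_Rn_fdd: "is_process \<mu> \<Longrightarrow> is_prob_Rn (length xs) (fdd \<mu> xs)"
  using measurable_fdd_map[of \<mu> xs] prob_space.prob_space_distr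
  by (auto simp: is_prob_Rn_def fdd_def is_process_def)

lemma integral_fdd:
  fixes g :: "(nat \<Rightarrow> real) \<Rightarrow> 'b::{banach, second_countable_topology}"
  assumes "is_process \<mu>" "g \<in> borel_measurable (Rn (length xs))"
  shows "(\<integral>y. g y \<partial>fdd \<mu> xs) = (\<integral>f. g (\<lambda>i\<in>{..<length xs}. f (xs ! i)) \<partial>\<mu>)"
  unfolding fdd_def using assms(2) by (rule integral_distr[OF measurable_fdd_map[OF assms(1)]])

lemma mean_vec_fdd:
  assumes "is_process \<mu>" "i < length xs"
  shows "mean_vec (fdd \<mu> xs) i = mean_fun \<mu> (xs ! i)"
  unfolding mean_vec_def mean_fun_def
  using assms measurable_coordinate_Rn[of "Rn (length xs)", OF refl assms(2)] by (subst integral_fdd) auto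

lemma cov_mat_fdd:
  assumes "is_process \<mu>" "i < length xs" "j < length xs"
  shows "cov_mat (fdd \<mu> xs) i j = cov_fun \<mu> (xs ! i) (xs ! j)"
proof -
  note [measurable] = measurable_coordinate_Rn[of "Rn (length xs)", OF refl assms(2)]
    measurable_coordinate_Rn[of "Rn (length xs)", OF refl assms(3)]
  show ?thesis unfolding cov_mat_def cov_fun_def mean_vec_fdd[OF assms(1,2)] mean_vec_fdd[OF assms(1,3)]
    using assms by (subst integral_fdd) auto
qed

section \<open>Existence of Gaussian processes\<close>

lemma posdef_on_cong:
  "(\<And>i j. i \<in> J \<Longrightarrow> j \<in> J \<Longrightarrow> V i j = W i j) \<Longrightarrow> posdef_on J V = posdef_on J W"
  unfolding posdef_on_def by (simp cong: sum.cong)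

text \<open>Passes between positions in a list of inputs, which index the laws on R^n, and the
  inputs themselves, which index covariance functions.\<close>

lemma posdef_on_bij_betw:
  assumes h: "bij_betw h A B"
  shows "posdef_on B K \<longleftrightarrow> posdef_on A (\<lambda>i j. K (h i) (h j))"
proof -
  have BA: "B = h ` A" and inj: "inj_on h A" using h by (auto simp: bij_betw_def)
  have inv: "the_inv_into A h (h i) = i" if "i \<in> A" for i using inj that by (rule the_inv_into_f_f)
  have S: "(\<Sum>i\<in>B. \<Sum>j\<in>B. b i * b j * K i j) = (\<Sum>i\<in>A. \<Sum>j\<in>A. b (h i) * b (h j) * K (h i) (h j))" for b
    unfolding sum.reindex_bij_betw[OF h, symmetric] ..
  show ?thesis
  proof
    assume L: "posdef_on B K"
    show "posdef_on A (\<lambda>i j. K (h i) (h j))"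
      unfolding posdef_on_def
    proof (intro conjI allI impI)
      show "\<forall>i\<in>A. \<forall>j\<in>A. K (h i) (h j) = K (h j) (h i)" using L BA by (auto simp: posdef_on_def)
      fix a assume "\<exists>j\<in>A. a j \<noteq> (0::real)"
      then have "\<exists>j\<in>B. a (the_inv_into A h j) \<noteq> 0" using BA inv by auto
      then have "(\<Sum>i\<in>B. \<Sum>j\<in>B. a (the_inv_into A h i) * a (the_inv_into A h j) * K i j) > 0"
        using L unfolding posdef_on_def by (elim conjE allE[of _ "\<lambda>j. a (the_inv_into A h j)"]) auto
      then show "(\<Sum>i\<in>A. \<Sum>j\<in>A. a i * a j * K (h i) (h j)) > 0" unfolding S by (simp add: inv cong: sum.cong)
    qed
  next
    assume R: "posdef_on A (\<lambda>i j. K (h i) (h j))"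
    show "posdef_on B K"
      unfolding posdef_on_def
    proof (intro conjI allI impI)
      show "\<forall>i\<in>B. \<forall>j\<in>B. K i j = K j i" using R BA by (auto simp: posdef_on_def)
      fix b assume "\<exists>j\<in>B. b j \<noteq> (0::real)"
      then have "\<exists>j\<in>A. b (h j) \<noteq> 0" using BA by auto
      then show "(\<Sum>i\<in>B. \<Sum>j\<in>B. b i * b j * K i j) > 0" unfolding S
        using R unfolding posdef_on_def by (elim conjE allE[of _ "\<lambda>j. b (h j)"]) auto
    qed
  qed
qed

text \<open>The laws \<open>G J\<close> are indexed by finite sets of inputs and known through their
  characteristic functions \<open>\<phi> J\<close>. Consistency becomes easy in this form:
  restricting to \<open>J\<close> means setting the frequencies outside \<open>J\<close> to
  0.\<close>

theorem gaussian_process_exists: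
  fixes m :: "real \<Rightarrow> real" and K :: "real \<Rightarrow> real \<Rightarrow> real"
  assumes K: "\<And>J. finite J \<Longrightarrow> posdef_on J K"
  shows "\<exists>\<nu>. gaussian_process \<nu> \<and> mean_fun \<nu> = m \<and> cov_fun \<nu> = K"
proof -
  let ?L = "\<lambda>J. PiM J (\<lambda>_::real. lborel :: real measure)"
  let ?B = "\<lambda>J. PiM J (\<lambda>_::real. borel :: real measure)"
  define \<phi> where "\<phi> J a = iexp (\<Sum>j\<in>J. a j * m j) * complex_of_real (exp (- (\<Sum>i\<in>J. \<Sum>j\<in>J. a i * a j * K i j) / 2))"
    for J a
  \<comment> \<open>The laws are set up over \<open>lborel\<close>, the projective limit over
    \<open>borel\<close>; the product sigma-algebras agree.\<close>
  have LB: "sets (?L J) = sets (?B J)" for J by (intro sets_PiM_cong) auto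
  have "\<exists>G. finite J \<longrightarrow> prob_space G \<and> sets G = sets (?L J) \<and> (\<forall>a. (\<integral>y. iexp (\<Sum>j\<in>J. a j * y j) \<partial>G) = \<phi> J a)" for J
  proof (cases "finite J")
    case True
    obtain q where q: "quadratic_log J q"
      and p: "prob_space (density (?L J) (\<lambda>y. ennreal (exp (q y))))"
      and c: "\<And>a. (\<integral>y. exp (q y) *\<^sub>R iexp (\<Sum>j\<in>J. a j * y j) \<partial>?L J) = \<phi> J a"
      using gaussian_density_exists[OF True K[OF True], of m] unfolding \<phi>_def by blast
    have [measurable]: "q \<in> borel_measurable (?L J)" by (rule quadratic_log_measurable[OF q refl])
    have "(\<integral>y. iexp (\<Sum>j\<in>J. a j * y j) \<partial>density (?L J) (\<lambda>y. ennreal (exp (q y)))) = \<phi> J a" for a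
      unfolding c[symmetric] by (subst integral_density) auto
    then show ?thesis using p by (intro exI[of _ "density (?L J) (\<lambda>y. ennreal (exp (q y)))"]) auto
  qed simp
  then have "\<forall>J. \<exists>G. finite J \<longrightarrow> prob_space G \<and> sets G = sets (?L J) \<and>
      (\<forall>a. (\<integral>y. iexp (\<Sum>j\<in>J. a j * y j) \<partial>G) = \<phi> J a)" by blast
  from choice[OF this] obtain G where pG: "\<And>J. finite J \<Longrightarrow> prob_space (G J)" and sG: "\<And>J. finite J \<Longrightarrow> sets (G J) = sets (?L J)"
    and cG: "\<And>J a. finite J \<Longrightarrow> (\<integral>y. iexp (\<Sum>j\<in>J. a j * y j) \<partial>G J) = \<phi> J a"
    by blast
  have proj: "G J = distr (G H) (?B J) (\<lambda>f. restrict f J)" if JH: "J \<subseteq> H" and H: "finite H" for J H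
  proof -
    have J: "finite J" using JH H by (rule finite_subset)
    note [measurable_cong] = sG[OF H]
    have r[measurable]: "(\<lambda>f. restrict f J) \<in> measurable (G H) (?B J)"
    proof (rule measurable_restrict)
      show "(\<lambda>x. x i) \<in> borel_measurable (G H)" if "i \<in> J" for i using that JH by auto
    qed
    show ?thesis
    proof (rule PiM_eqI_char[OF J pG[OF J]])
      show "prob_space (distr (G H) (?B J) (\<lambda>f. restrict f J))"
        by (rule prob_space.prob_space_distr[OF pG[OF H] r])
      show "sets (G J) = sets (?L J)" by (rule sG[OF J])
      show "sets (distr (G H) (?B J) (\<lambda>f. restrict f J)) = sets (?L J)" by (simp add: LB)
      fix a :: "real \<Rightarrow> real"
      define b where "b j = (if j \<in> J then a j else 0)" for j
      have b: "(\<Sum>j\<in>H. b j * y j) = (\<Sum>j\<in>J. a j * y j)" for y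
        using JH H by (intro sum.mono_neutral_cong_right) (auto simp: b_def)
      have bb: "(\<Sum>i\<in>H. \<Sum>j\<in>H. b i * b j * K i j) = (\<Sum>i\<in>J. \<Sum>j\<in>J. a i * a j * K i j)"
        using b[of "K _"] JH H unfolding mult.assoc sum_distrib_left[symmetric]
        by (intro sum.mono_neutral_cong_right) (auto simp: b_def)
      have "(\<integral>y. iexp (\<Sum>j\<in>J. a j * y j) \<partial>distr (G H) (?B J) (\<lambda>f. restrict f J)) =
        (\<integral>y. iexp (\<Sum>j\<in>J. a j * restrict y J j) \<partial>G H)"
        by (subst integral_distr) auto
      also have "\<dots> = (\<integral>y. iexp (\<Sum>j\<in>H. b j * y j) \<partial>G H)" by (simp add: b)
      also have "\<dots> = \<phi> H b" by (rule cG[OF H])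
      also have "\<dots> = \<phi> J a" unfolding \<phi>_def bb b ..
      finally show "(\<integral>y. iexp (\<Sum>j\<in>J. a j * y j) \<partial>G J) =
        (\<integral>y. iexp (\<Sum>j\<in>J. a j * y j) \<partial>distr (G H) (?B J) (\<lambda>f. restrict f J))"
        by (simp only: cG[OF J])
    qed
  qed
  interpret polish_projective UNIV G
    by (intro polish_projective.intro projective_family.intro proj pG)
  define \<nu> where "\<nu> = lim"
  have proc: "is_process \<nu>"
    using P.prob_space_axioms by (simp add: is_process_def \<nu>_def sets_path_space)
  have marg: "distr \<nu> (?B J) (\<lambda>f. restrict f J) = G J" if J: "finite J" for J
  proof (rule measure_eqI)
    fix X assume "X \<in> sets (distr \<nu> (?B J) (\<lambda>f. restrict f J))"
    then have X: "X \<in> sets (?B J)" by simp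
    have r: "(\<lambda>f. restrict f J) \<in> measurable \<nu> (?B J)"
      using measurable_process_coordinate[OF proc] by (intro measurable_restrict) simp
    have "emeasure (distr \<nu> (?B J) (\<lambda>f. restrict f J)) X = emeasure lim (prod_emb UNIV (\<lambda>_. borel) J X)"
      using X r by (subst emeasure_distr) (auto simp: \<nu>_def prod_emb_def space_PiM)
    also have "\<dots> = emeasure (G J) X" using J X by (intro emeasure_lim_emb) auto
    finally show "emeasure (distr \<nu> (?B J) (\<lambda>f. restrict f J)) X = emeasure (G J) X" .
  qed (use J in \<open>simp add: sG LB\<close>)
  have char: "(\<integral>f. iexp (\<Sum>j\<in>J. a j * f j) \<partial>\<nu>) = \<phi> J a" if J: "finite J" for J a
  proof -
    have r: "(\<lambda>f. restrict f J) \<in> measurable \<nu> (?B J)"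
      using measurable_process_coordinate[OF proc] by (intro measurable_restrict) simp
    have "\<phi> J a = (\<integral>f. iexp (\<Sum>j\<in>J. a j * restrict f J j) \<partial>\<nu>)"
      unfolding cG[OF J, symmetric] marg[OF J, symmetric] by (subst integral_distr[OF r]) auto
    then show ?thesis by simp
  qed
  have fd: "gaussian_Rn (length xs) (fdd \<nu> xs) \<and> (\<forall>i<length xs. mean_vec (fdd \<nu> xs) i = m (xs ! i)) \<and>
     (\<forall>i<length xs. \<forall>j<length xs. cov_mat (fdd \<nu> xs) i j = K (xs ! i) (xs ! j))" if xs: "distinct xs" for xs
  proof -
    let ?n = "length xs"
    have bij: "bij_betw ((!) xs) {..<?n} (set xs)" using xs by (intro bij_betw_nth) auto
    have pd: "posdef_on {..<?n} (\<lambda>i j. K (xs ! i) (xs ! j))"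
      using K[of "set xs"] posdef_on_bij_betw[OF bij] by simp
    have 1: "(\<integral>y. iexp (\<Sum>i<?n. a i * y i) \<partial>fdd \<nu> xs) = iexp (\<Sum>i<?n. a i * m (xs ! i)) *
       of_real (exp (- (\<Sum>i<?n. \<Sum>j<?n. a i * a j * K (xs ! i) (xs ! j)) / 2))" for a
    proof -
      \<comment> \<open>Frequencies given by position become frequencies attached to inputs; the
        inversion is possible because the entries of \<open>xs\<close> are distinct.\<close>
      define b where "b t = a (the_inv_into {..<?n} ((!) xs) t)" for t
      have b: "b (xs ! i) = a i" if "i < ?n" for i
        unfolding b_def using bij that by (subst the_inv_into_f_f) (auto simp: bij_betw_def)
      have [measurable]: "(\<lambda>y. \<Sum>i<?n. a i * y i) \<in> borel_measurable (Rn ?n)" by (rule measurable_linear_Rn) simp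
      have "(\<lambda>y. iexp (\<Sum>i<?n. a i * y i)) \<in> borel_measurable (Rn ?n)" by measurable
      then have "(\<integral>y. iexp (\<Sum>i<?n. a i * y i) \<partial>fdd \<nu> xs) = (\<integral>f. iexp (\<Sum>i<?n. b (xs ! i) * f (xs ! i)) \<partial>\<nu>)"
        by (subst integral_fdd[OF proc]) (auto simp: b)
      also have "\<dots> = \<phi> (set xs) b"
        unfolding sum.reindex_bij_betw[OF bij, of "\<lambda>t. b t * _ t"] by (rule char) simp
      also have "\<dots> = iexp (\<Sum>i<?n. a i * m (xs ! i)) *
          of_real (exp (- (\<Sum>i<?n. \<Sum>j<?n. a i * a j * K (xs ! i) (xs ! j)) / 2))"
        unfolding \<phi>_def sum.reindex_bij_betw[OF bij, symmetric] by (simp add: b)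
      finally show ?thesis .
    qed
    show ?thesis
      using gaussian_RnI_char[OF is_prob_Rn_fdd[OF proc] 1 posdef_on_nonneg[OF pd]] pd
      unfolding posdef_on_def by auto
  qed
  have "mean_fun \<nu> t = m t" for t
    using fd[of "[t]"] mean_vec_fdd[OF proc, of 0 "[t]"] by simp
  \<comment> \<open>Inputs must be pairwise distinct, so \<open>[s, t]\<close> is admissible only
    for \<open>s \<noteq> t\<close>, and the variance at \<open>t\<close> comes from
    \<open>[t]\<close>.\<close>
  moreover have "cov_fun \<nu> s t = K s t" for s t
  proof (cases "s = t")
    case True
    then show ?thesis using fd[of "[t]"] cov_mat_fdd[OF proc, of 0 "[t]" 0] by simp
  next
    case False
    then show ?thesis using fd[of "[s, t]"] cov_mat_fdd[OF proc, of 0 "[s, t]" 1] by simp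
  qed
  ultimately show ?thesis
    using fd proc by (intro exI[of _ \<nu>]) (auto simp: gaussian_process_def inputs_def fun_eq_iff)
qed

section \<open>Uniqueness of processes and the Gaussian process \<open>GP_of\<close>\<close>

lemma process_eqI_fdd:
  assumes \<mu>: "is_process \<mu>" and \<nu>: "is_process \<nu>" and eq: "\<And>xs. xs \<in> inputs \<Longrightarrow> fdd \<mu> xs = fdd \<nu> xs"
  shows "\<mu> = \<nu>"
proof (rule measure_eqI_PiM_infinite[where I=UNIV and M="\<lambda>_. lborel"])
  show "sets \<mu> = sets (PiM UNIV (\<lambda>_. lborel))" "sets \<nu> = sets (PiM UNIV (\<lambda>_. lborel))"
    using \<mu> \<nu> by (auto simp: is_process_def path_space_def)
  have prob: "prob_space \<mu>" "prob_space \<nu>" using \<mu> \<nu> by (auto simp: is_process_def)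
  show "finite_measure \<mu>" using prob by (simp add: prob_space_def)
  fix A :: "real \<Rightarrow> real set" and J :: "real set"
  assume J: "finite J" and A: "\<And>t. t \<in> J \<Longrightarrow> A t \<in> sets lborel"
  show "emeasure \<mu> (prod_emb UNIV (\<lambda>_. lborel) J (Pi\<^sub>E J A)) = emeasure \<nu> (prod_emb UNIV (\<lambda>_. lborel) J (Pi\<^sub>E J A))"
  \<comment> \<open>\<open>inputs\<close> excludes the empty list, so the cylinder over no
    coordinates, which is the whole space, is compared by total mass.\<close>
  proof (cases "J = {}")
    case True
    have "space \<mu> = UNIV" "space \<nu> = UNIV"
      using \<mu> \<nu> sets_eq_imp_space_eq[of _ path_space] by (auto simp: is_process_def path_space_def space_PiM)
    then show ?thesis
      using True prob_space.emeasure_space_1[OF prob(1)] prob_space.emeasure_space_1[OF prob(2)]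
      by (simp add: prod_emb_def space_PiM vimage_def restrict_def)
  next
    case False
    define xs where "xs = sorted_list_of_set J"
    have xs: "xs \<in> inputs" "set xs = J" "distinct xs" using J False by (auto simp: xs_def inputs_def)
    let ?n = "length xs"
    have S: "Pi\<^sub>E {..<?n} (\<lambda>i. A (xs ! i)) \<in> sets (Rn ?n)"
      unfolding Rn_def using A xs by (intro sets_PiM_I_finite) auto
    have *: "emeasure \<rho> (prod_emb UNIV (\<lambda>_. lborel) J (Pi\<^sub>E J A)) = emeasure (fdd \<rho> xs) (Pi\<^sub>E {..<?n} (\<lambda>i. A (xs ! i)))"
      if \<rho>: "is_process \<rho>" for \<rho>
    proof -
      have sp: "space \<rho> = UNIV"
        using \<rho> sets_eq_imp_space_eq[of _ path_space] by (auto simp: is_process_def path_space_def space_PiM)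
      have "(\<forall>t\<in>set xs. f t \<in> A t) \<longleftrightarrow> (\<forall>i<?n. f (xs ! i) \<in> A (xs ! i))" for f
        by (simp add: all_set_conv_all_nth)
      then have "prod_emb UNIV (\<lambda>_. lborel) J (Pi\<^sub>E J A) =
          (\<lambda>f. \<lambda>i\<in>{..<?n}. f (xs ! i)) -` Pi\<^sub>E {..<?n} (\<lambda>i. A (xs ! i)) \<inter> space \<rho>"
        unfolding sp xs(2)[symmetric] by (auto simp: prod_emb_def space_PiM PiE_iff)
      then show ?thesis unfolding fdd_def using emeasure_distr[OF measurable_fdd_map[OF \<rho>] S] by simp
    qed
    show ?thesis unfolding *[OF \<mu>] *[OF \<nu>] eq[OF xs(1)] ..
  qed
qed

lemma gaussian_process_eqI:
  assumes "gaussian_process \<mu>" "gaussian_process \<nu>" "mean_fun \<mu> = mean_fun \<nu>" "cov_fun \<mu> = cov_fun \<nu>"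
  shows "\<mu> = \<nu>"
proof -
  have p: "is_process \<mu>" "is_process \<nu>" using assms by (auto simp: gaussian_process_def)
  show ?thesis
    using assms by (intro process_eqI_fdd p gaussian_Rn_eqI)
      (auto simp: gaussian_process_def mean_vec_fdd[OF p(1)] mean_vec_fdd[OF p(2)] cov_mat_fdd[OF p(1)] cov_mat_fdd[OF p(2)])
qed

lemma nondegenerate_proc_posdef_on:
  assumes \<mu>: "is_process \<mu>" "nondegenerate_proc \<mu>" and J: "finite J"
  shows "posdef_on J (cov_fun \<mu>)"
proof (cases "J = {}")
  case False
  define xs where "xs = sorted_list_of_set J"
  have xs: "xs \<in> inputs" "set xs = J" "distinct xs" using J False by (auto simp: xs_def inputs_def)
  have bij: "bij_betw ((!) xs) {..<length xs} J" using xs by (intro bij_betw_nth) auto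
  have "posdef_on {..<length xs} (cov_mat (fdd \<mu> xs))"
    using \<mu>(2) xs(1) by (intro nondegenerate_Rn_posdef_on) (auto simp: nondegenerate_proc_def)
  then have "posdef_on {..<length xs} (\<lambda>i j. cov_fun \<mu> (xs ! i) (xs ! j))"
    by (subst (asm) posdef_on_cong[where W="\<lambda>i j. cov_fun \<mu> (xs ! i) (xs ! j)"]) (auto simp: cov_mat_fdd[OF \<mu>(1)])
  then show ?thesis by (simp only: posdef_on_bij_betw[OF bij])
qed (simp add: posdef_on_def)

lemma GP_of:
  assumes "is_process \<mu>" "nondegenerate_proc \<mu>"
  shows "gaussian_process (GP_of \<mu>)" "mean_fun (GP_of \<mu>) = mean_fun \<mu>" "cov_fun (GP_of \<mu>) = cov_fun \<mu>"
proof -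
  have "\<exists>!\<nu>. gaussian_process \<nu> \<and> mean_fun \<nu> = mean_fun \<mu> \<and> cov_fun \<nu> = cov_fun \<mu>"
    using gaussian_process_exists[OF nondegenerate_proc_posdef_on[OF assms], of "mean_fun \<mu>"]
    by (auto intro!: gaussian_process_eqI)
  from theI'[OF this] show "gaussian_process (GP_of \<mu>)" "mean_fun (GP_of \<mu>) = mean_fun \<mu>"
    "cov_fun (GP_of \<mu>) = cov_fun \<mu>" by (auto simp: GP_of_def)
qed

section \<open>Monotonicity in the inputs, suprema and conclusion\<close>

lemma fdd_subset:
  assumes "set xs \<subseteq> set ys"
  shows "\<exists>T \<in> measurable (Rn (length ys)) (Rn (length xs)).
    \<forall>\<nu>. is_process \<nu> \<longrightarrow> fdd \<nu> xs = distr (fdd \<nu> ys) (Rn (length xs)) T"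
proof -
  have "\<forall>i. \<exists>k. i < length xs \<longrightarrow> k < length ys \<and> ys ! k = xs ! i"
    using assms by (metis in_set_conv_nth nth_mem subsetD)
  then obtain k where k: "\<And>i. i < length xs \<Longrightarrow> k i < length ys \<and> ys ! k i = xs ! i" by metis
  \<comment> \<open>The positions \<open>k\<close> depend on \<open>xs\<close> and \<open>ys\<close>
    alone, so one map \<open>T\<close> serves every process. Data processing requires this, since
    both laws have to be pushed forward by the same map.\<close>
  define T where "T y = (\<lambda>i\<in>{..<length xs}. y (k i))" for y :: "nat \<Rightarrow> real"
  have T: "T \<in> measurable (Rn (length ys)) (Rn (length xs))"
    unfolding T_def using k measurable_coordinate_Rn[of "Rn (length ys)", OF refl]
    by (subst (2) Rn_def) (intro measurable_restrict, auto)
  have "fdd \<nu> xs = distr (fdd \<nu> ys) (Rn (length xs)) T" if "is_process \<nu>" for \<nu>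
    unfolding fdd_def distr_distr[OF T measurable_fdd_map[OF that]]
    by (intro distr_cong refl) (auto simp: T_def k restrict_def)
  with T show ?thesis by blast
qed

lemma KL_fdd_mono:
  assumes "is_process \<mu>" "is_process \<nu>" "set xs \<subseteq> set ys"
  shows "KL (fdd \<mu> xs) (fdd \<nu> xs) \<le> KL (fdd \<mu> ys) (fdd \<nu> ys)"
proof -
  obtain T where T: "T \<in> measurable (Rn (length ys)) (Rn (length xs))"
    "\<And>\<nu>. is_process \<nu> \<Longrightarrow> fdd \<nu> xs = distr (fdd \<nu> ys) (Rn (length xs)) T"
    using fdd_subset[OF assms(3)] by blast
  have "prob_space (fdd \<mu> ys)" "prob_space (fdd \<nu> ys)" and s: "sets (fdd \<nu> ys) = sets (Rn (length ys))"
    using is_prob_Rn_fdd[OF assms(1), of ys] is_prob_Rn_fdd[OF assms(2), of ys] by (auto simp: is_prob_Rn_def)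
  then show ?thesis unfolding T(2)[OF assms(1)] T(2)[OF assms(2)]
    using T(1) by (intro KL_distr_le) (auto simp: measurable_cong_sets[OF s refl])
qed

text \<open>In general the two suprema are approached along different arguments. \<open>dir\<close>
  replaces \<open>x\<close> and \<open>y\<close> by one \<open>z\<close> that is at least as good
  for both, and nonnegativity keeps the sums of extended reals well behaved.\<close>

lemma SUP_add_directed:
  fixes a b :: "'a \<Rightarrow> ereal"
  assumes "I \<noteq> {}" and nn: "\<And>x. x \<in> I \<Longrightarrow> 0 \<le> a x" "\<And>x. x \<in> I \<Longrightarrow> 0 \<le> b x"
    and dir: "\<And>x y. x \<in> I \<Longrightarrow> y \<in> I \<Longrightarrow> \<exists>z\<in>I. a x \<le> a z \<and> b y \<le> b z"
  shows "(SUP x\<in>I. a x + b x) = (SUP x\<in>I. a x) + (SUP x\<in>I. b x)"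
proof (rule antisym)
  show "(SUP x\<in>I. a x + b x) \<le> (SUP x\<in>I. a x) + (SUP x\<in>I. b x)"
    by (intro SUP_least add_mono SUP_upper)
  have "a x + b y \<le> (SUP x\<in>I. a x + b x)" if xy: "x \<in> I" "y \<in> I" for x y
  proof -
    obtain z where z: "z \<in> I" "a x \<le> a z" "b y \<le> b z" using dir[OF xy] by blast
    have "a x + b y \<le> a z + b z" using z by (intro add_mono)
    also have "\<dots> \<le> (SUP x\<in>I. a x + b x)" using z by (intro SUP_upper)
    finally show ?thesis .
  qed
  then have "a x + (SUP y\<in>I. b y) \<le> (SUP x\<in>I. a x + b x)" if "x \<in> I" for x
    using that nn assms(1) by (subst SUP_ereal_add_right[symmetric]) (auto intro!: SUP_least)
  moreover obtain x where "x \<in> I" using assms(1) by blast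
  then have "0 \<le> (SUP y\<in>I. b y)" using nn(2) by (intro SUP_upper2)
  then have "(SUP y\<in>I. b y) \<noteq> - \<infinity>" by auto
  ultimately show "(SUP x\<in>I. a x) + (SUP x\<in>I. b x) \<le> (SUP x\<in>I. a x + b x)"
    using assms(1) by (subst SUP_ereal_add_left[symmetric]) (auto intro!: SUP_least)
qed

theorem mainTheorem3:
  fixes \<mu> \<mu>G \<nu> :: "(real \<Rightarrow> real) measure"
  assumes "in_P_lambda \<mu>" and "nondegenerate_proc \<mu>"
    and "gaussian_process \<mu>G" and "nondegenerate_proc \<mu>G" and "KL_proc \<mu> \<mu>G < \<infinity>"
    and "gaussian_process \<nu>" and "nondegenerate_proc \<nu>"
  shows "KL_proc \<mu> (GP_of \<mu>) < \<infinity> \<and>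
         KL_proc \<mu> \<nu> - KL_proc \<mu> (GP_of \<mu>) = gauss_div \<mu> \<nu>"
proof -
  define \<gamma> where "\<gamma> = GP_of \<mu>"
  have \<mu>: "is_process \<mu>" and \<nu>: "is_process \<nu>" using assms(1,6) by (auto simp: in_P_lambda_def gaussian_process_def)
  note G = GP_of[OF \<mu> assms(2), folded \<gamma>_def]
  have \<gamma>: "is_process \<gamma>" using G(1) by (simp add: gaussian_process_def)
  have moments: "mean_vec (fdd \<mu> xs) i = mean_vec (fdd \<gamma> xs) i" "cov_mat (fdd \<mu> xs) i j = cov_mat (fdd \<gamma> xs) i j"
    if "i < length xs" "j < length xs" for xs i j
    using that G by (simp_all add: mean_vec_fdd[OF \<mu>] mean_vec_fdd[OF \<gamma>] cov_mat_fdd[OF \<mu>] cov_mat_fdd[OF \<gamma>])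
  have P: "is_prob_Rn (length xs) (fdd \<mu> xs)" "has_lebesgue_density (length xs) (fdd \<mu> xs)"
    "nondegenerate_Rn (length xs) (fdd \<mu> xs)" and Gx: "gaussian_Rn (length xs) (fdd \<gamma> xs)"
    and GG: "gaussian_Rn (length xs) (fdd \<mu>G xs)"
    and Q: "gaussian_Rn (length xs) (fdd \<nu> xs)" "posdef_on {..<length xs} (cov_mat (fdd \<nu> xs))"
    if "xs \<in> inputs" for xs
    using that assms G(1) is_prob_Rn_fdd[OF \<mu>]
    by (auto simp: in_P_lambda_def nondegenerate_proc_def gaussian_process_def intro!: nondegenerate_Rn_posdef_on)
  define a where "a xs = KL (fdd \<mu> xs) (fdd \<gamma> xs)" for xs
  define b where "b xs = KL (fdd \<gamma> xs) (fdd \<nu> xs)" for xs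
  have prob: "prob_space (fdd \<rho> xs)" if "is_process \<rho>" for \<rho> xs
    using is_prob_Rn_fdd[OF that] by (auto simp: is_prob_Rn_def)
  have ne: "inputs \<noteq> {}" by (auto simp: inputs_def intro!: exI[of _ "[0]"])
  have sup_a: "(SUP xs\<in>inputs. a xs) < \<infinity>"
  proof -
    have "a xs \<le> KL (fdd \<mu> xs) (fdd \<mu>G xs)" if "xs \<in> inputs" for xs
      unfolding a_def using that moments by (intro KL_gaussian_projection_le[OF P Gx _ _ GG]) auto
    then have "(SUP xs\<in>inputs. a xs) \<le> KL_proc \<mu> \<mu>G"
      unfolding KL_proc_def by (intro SUP_mono) auto
    then show ?thesis using assms(5) by (rule le_less_trans)
  qed
  have a_fin: "a xs \<noteq> \<infinity>" if "xs \<in> inputs" for xs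
    using SUP_upper[OF that, of a] sup_a by auto
  have pyth: "KL (fdd \<mu> xs) (fdd \<nu> xs) = a xs + b xs" if "xs \<in> inputs" for xs
    unfolding a_def b_def using that moments by (intro KL_gaussian_pythagoras(1)[OF P Gx _ _ Q]) auto
  have div: "gauss_div_Rn (length xs) (fdd \<mu> xs) (fdd \<nu> xs) = b xs" if "xs \<in> inputs" for xs
    unfolding b_def using that moments a_fin[OF that]
    by (intro gauss_div_Rn_eq_KL[OF P Gx _ _ Q]) (auto simp: a_def)
  have "KL_proc \<mu> \<nu> = (SUP xs\<in>inputs. a xs + b xs)"
    unfolding KL_proc_def using pyth by (intro SUP_cong) auto
  also have "\<dots> = (SUP xs\<in>inputs. a xs) + (SUP xs\<in>inputs. b xs)"
  proof (rule SUP_add_directed[OF ne])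
    show "0 \<le> a xs" "0 \<le> b xs" for xs
      unfolding a_def b_def using prob \<mu> \<nu> \<gamma> by (auto intro!: KL_nonneg)
    fix xs ys assume "xs \<in> inputs" "ys \<in> inputs"
    \<comment> \<open>The concatenation contains both sets of inputs, and \<open>remdups\<close>
      restores the distinctness that \<open>inputs\<close> demands.\<close>
    then have "remdups (xs @ ys) \<in> inputs" by (auto simp: inputs_def)
    moreover have "a xs \<le> a (remdups (xs @ ys))" "b ys \<le> b (remdups (xs @ ys))"
      unfolding a_def b_def using \<mu> \<nu> \<gamma> by (intro KL_fdd_mono; auto)+
    ultimately show "\<exists>zs\<in>inputs. a xs \<le> a zs \<and> b ys \<le> b zs" by blast
  qed
  finally have sum: "KL_proc \<mu> \<nu> = (SUP xs\<in>inputs. a xs) + (SUP xs\<in>inputs. b xs)" .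
  have nn: "0 \<le> (SUP xs\<in>inputs. a xs)"
    using prob \<mu> \<gamma> by (intro SUP_upper2[of "[0]"]) (auto simp: a_def inputs_def intro!: KL_nonneg)
  have "gauss_div \<mu> \<nu> = (SUP xs\<in>inputs. b xs)"
    unfolding gauss_div_def using div by (intro SUP_cong) auto
  moreover have "KL_proc \<mu> (GP_of \<mu>) = (SUP xs\<in>inputs. a xs)"
    by (simp add: KL_proc_def a_def \<gamma>_def)
  \<comment> \<open>The supremum of \<open>a\<close> is nonnegative and finite, so it cancels in the
    extended reals even if the supremum of \<open>b\<close> is \<infinity>.\<close>
  ultimately show ?thesis
    using sup_a nn unfolding sum
    by (cases "SUP xs\<in>inputs. a xs"; cases "SUP xs\<in>inputs. b xs") auto
qed

end
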